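(* Let $G$ be a finitely generated group, let $S\subseteq G$ be a finite generating set for $G$, and let $r\ge 1$ be a natural number. Let $(G,X)$ be a topological dynamical system with $\dim(X)<+\infty$ such that for every $N\in\mathbb{N}$ it holds that $$\dim (G,X)_N<\frac{rN}{2}.$$ Let $S^{\bullet 0}:=\{e_G\}$ and, for a natural number $n$, let $$S^{\bullet n}=\{s_1\cdots s_n : s_1,\ldots,s_n\in S\}\quad\text{and}\quad S^{\le\bullet n}=\bigcup_{k=0}^n S^{\bullet k},$$ with $S^{\le\bullet 0}=\{e_G\}$. Let $M$ be the smallest natural number which satisfies $M>\frac{2\dim(X)}{r}$, and let $F=S^{\le\bullet(M-1)}$. Then the set of continuous functions $f:X\to[0,1]^r$ such that $$f^F:X\to([0,1]^r)^F,\quad x\mapsto (f(gx))_{g\in F}$$ is an embedding is comeagre in $C(X,[0,1]^r)$.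
   Context: $\mathbb{N}=\{1,2,\dots\}$. A topological dynamical system $(G,X)$ consists of a group $G$ (with the discrete topology) acting on a compact metric space $X$ so that the action map $G\times X\to X$, $(g,x)\mapsto gx$, is continuous. $(G,X)_N:=\{x\in X:|G\cdot x|\le N\}$, where $G\cdot x=\{gx:g\in G\}$. $e_G$ is the identity of $G$. A subset $S\subseteq G$ is a generating set if every element of $G$ is a finite product of elements of $S\cup S^{-1}\cup\{e_G\}$. $\dim$ denotes Lebesgue covering dimension. $C(X,[0,1]^r)$ is the space of continuous functions $X\to[0,1]^r$ with the topology of uniform convergence. Embedding means topological embedding (equivalently here, an injective continuous map). *)

theory Defs
  imports "HOL-Analysis.Analysis" "HOL-Algebra.Group_Action" "HOL-Algebra.Generated_Groups"
begin

section \<open>Lebesgue covering dimension\<close>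

definition finite_open_cover :: "'a topology \<Rightarrow> 'a set set \<Rightarrow> bool" where
  "finite_open_cover T \<U> \<longleftrightarrow> finite \<U> \<and> (\<forall>U\<in>\<U>. openin T U) \<and> \<Union>\<U> = topspace T"

definition refines :: "'a set set \<Rightarrow> 'a set set \<Rightarrow> bool" where
  "refines \<V> \<U> \<longleftrightarrow> (\<forall>V\<in>\<V>. \<exists>U\<in>\<U>. V \<subseteq> U)"

definition covering_dim_le :: "'a topology \<Rightarrow> int \<Rightarrow> bool" where
  "covering_dim_le T n \<longleftrightarrow>
     (\<forall>\<U>. finite_open_cover T \<U> \<longrightarrow>
       (\<exists>\<V>. finite_open_cover T \<V> \<and> refines \<V> \<U> \<and>
            (\<forall>x\<in>topspace T. int (card {V\<in>\<V>. x \<in> V}) \<le> n + 1)))"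

text \<open>The empty space has dimension \<open>-1\<close>; the value is \<open>\<infinity>\<close> if no finite bound exists.\<close>

definition covering_dim :: "'a topology \<Rightarrow> ereal" where
  "covering_dim T = Inf {ereal (real_of_int n) | n. n \<ge> -1 \<and> covering_dim_le T n}"


section \<open>Comeagre sets\<close>

definition nowhere_dense_in :: "'a topology \<Rightarrow> 'a set \<Rightarrow> bool" where
  "nowhere_dense_in T A \<longleftrightarrow> A \<subseteq> topspace T \<and> T interior_of (T closure_of A) = {}"

definition meagre_in :: "'a topology \<Rightarrow> 'a set \<Rightarrow> bool" where
  "meagre_in T A \<longleftrightarrow> (\<exists>\<N>. countable \<N> \<and> (\<forall>B\<in>\<N>. nowhere_dense_in T B) \<and> A = \<Union>\<N>)"

definition comeagre_in :: "'a topology \<Rightarrow> 'a set \<Rightarrow> bool" where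
  "comeagre_in T A \<longleftrightarrow> A \<subseteq> topspace T \<and> meagre_in T (topspace T - A)"


section \<open>Topological dynamical systems\<close>

locale topological_dynamical_system = group_action G "mspace X" \<phi>
  for G (structure) and X :: "'x metric" and \<phi> +
  assumes compact: "compact_space (mtopology_of X)"
    and continuous_action:
      "continuous_map (prod_topology (discrete_topology (carrier G)) (mtopology_of X))
         (mtopology_of X) (\<lambda>(g, x). \<phi> g x)"

text \<open>The finiteness conjunct is needed because \<^const>\<open>card\<close> is \<open>0\<close> on infinite sets.\<close>

definition small_orbit_points ::
    "('g, 'm) monoid_scheme \<Rightarrow> 'x metric \<Rightarrow> ('g \<Rightarrow> 'x \<Rightarrow> 'x) \<Rightarrow> nat \<Rightarrow> 'x set" where
  "small_orbit_points G X \<phi> N =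
     {x \<in> mspace X. finite (orbit G \<phi> x) \<and> card (orbit G \<phi> x) \<le> N}"


section \<open>Products of elements of a subset of a group\<close>

definition products_of_length :: "('g, 'm) monoid_scheme \<Rightarrow> 'g set \<Rightarrow> nat \<Rightarrow> 'g set" where
  "products_of_length G S n =
     {foldr (mult G) ss \<one>\<^bsub>G\<^esub> | ss. length ss = n \<and> set ss \<subseteq> S}"

definition products_up_to_length :: "('g, 'm) monoid_scheme \<Rightarrow> 'g set \<Rightarrow> nat \<Rightarrow> 'g set" where
  "products_up_to_length G S n = (\<Union>k\<in>{0..n}. products_of_length G S k)"


section \<open>The cube\<close>

text \<open>The dimension of the cube is \<open>CARD('r)\<close>.\<close>

definition unit_cube :: "(real ^ 'r) metric" where
  "unit_cube = submetric euclidean_metric {v. \<forall>i. v $ i \<in> {0..1}}"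

end

theory Submission
  imports Defs
begin

text \<open>
  A continuous map on the compact space \<open>X\<close> is an embedding as soon as it is injective, so the bad
  functions are those that fail to separate some pair \<open>x \<noteq> y\<close> along \<open>F\<close>. The pairs are covered by
  countably many compact sets \<open>Z\<close>, and it suffices that for each \<open>Z\<close> the functions separating
  every pair of \<open>Z\<close> are dense (they form an open set by compactness).

  To separate the pairs near \<open>(x\<^sub>0, y\<^sub>0)\<close>, consider the graph on \<open>V = F x\<^sub>0 \<union> F y\<^sub>0\<close> with edges
  \<open>g x\<^sub>0 - g y\<^sub>0\<close>. It has no isolated vertices, hence a spanning forest of stars with at least \<open>card V / 2\<close>
  leaves. Let \<open>C\<close> be a small closed neighbourhood of \<open>x\<^sub>0\<close> inside the set of points with the same
  coincidences \<open>g x = h x\<close> and inside \<open>(G, X)\<^sub>N\<close> if the orbit of \<open>x\<^sub>0\<close> has \<open>N < M\<close> elements. The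
  translates of \<open>C\<close> are disjoint, so the function may be replaced on them independently by a
  simplicial approximation that factors through a complex of dimension \<open>dim C\<close>, plus a small constant
  on each leaf. A pair that is not separated makes the vector of constants lie in one of finitely many
  affine subspaces, whose dimension is less than the number of free constants, which is at least
  \<open>r card V / 2\<close>, because \<open>card (F x) \<ge> min M (card (G x))\<close>.
\<close>

section \<open>Linear algebra and a spanning star forest\<close>

text \<open>
  Elimination of one unknown per row \<open>k\<close>. The right-hand side \<open>t k\<close> is only required to avoid the
  finitely many ratios \<open>p i k / s i\<close>; then \<open>\<psi> i = p i k - t k * s i\<close> is nonzero at an index with
  \<open>s i \<noteq> 0\<close>, which serves as the pivot.
\<close>

lemma avoid_affine_solutions:
  fixes K :: "'k set" and \<A> :: "('i set \<times> ('i \<Rightarrow> real) \<times> ('i \<Rightarrow> 'k \<Rightarrow> real)) set"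
  assumes "finite K" and "finite \<A>"
    and "\<And>I s p. (I, s, p) \<in> \<A> \<Longrightarrow> finite I \<and> card I \<le> card K"
    and "\<epsilon> > 0"
  shows "\<exists>t. (\<forall>k\<in>K. 0 < t k \<and> t k < \<epsilon>) \<and>
    (\<forall>I s p c. (I, s, p) \<in> \<A> \<longrightarrow> (\<Sum>i\<in>I. c i * s i) = 1 \<longrightarrow>
        (\<exists>k\<in>K. (\<Sum>i\<in>I. c i * p i k) \<noteq> t k))"
  using assms
proof (induction K arbitrary: \<A> rule: finite_induct)
  case empty
  \<comment> \<open>Without rows there are no unknowns either, and an empty sum cannot equal
    \<open>1\<close>.\<close>
  have "I = {}" if "(I, s, p) \<in> \<A>" for I s p
    using empty(2)[OF that] by auto
  then show ?case by fastforce
next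
  case (insert k K)
  define B where "B = (\<Union>(I, s, p)\<in>\<A>. (\<lambda>i. p i k / s i) ` I)"
  have "finite B"
    unfolding B_def using insert.prems by auto
  then have "infinite ({0<..<\<epsilon>} - B)"
    using \<open>\<epsilon> > 0\<close> by (simp add: Diff_infinite_finite infinite_Ioo)
  then obtain \<tau> where \<tau>: "0 < \<tau>" "\<tau> < \<epsilon>" "\<tau> \<notin> B"
    by (metis DiffD1 DiffD2 finite.emptyI greaterThanLessThan_iff ex_in_conv)
  define \<psi> where "\<psi> s p i = p i k - \<tau> * s i" for s :: "'i \<Rightarrow> real" and p :: "'i \<Rightarrow> 'k \<Rightarrow> real" and i
  define piv where "piv I s = (SOME i. i \<in> I \<and> s i \<noteq> 0)" for I and s :: "'i \<Rightarrow> real"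
  \<comment> \<open>Row \<open>k\<close> and the normalisation combine to the homogeneous relation
    \<open>(\<Sum>i\<in>I. c i * \<psi> s p i) = 0\<close>, which expresses the pivot coefficient
    through the others. Substituting it turns the normalisation and the remaining rows into sums
    over \<open>I - {piv I s}\<close> with these new coefficients.\<close>
  define elim where "elim = (\<lambda>(I, s, p). (I - {piv I s},
      \<lambda>i. s i - \<psi> s p i / \<psi> s p (piv I s) * s (piv I s),
      \<lambda>i l. p i l - \<psi> s p i / \<psi> s p (piv I s) * p (piv I s) l))"
  \<comment> \<open>If \<open>s\<close> vanishes on \<open>I\<close>, the normalisation has no
    solution, so such systems are dropped. Every other system loses one index, just as one row is
    lost.\<close>
  define \<A>' where "\<A>' = elim ` {(I, s, p)\<in>\<A>. \<exists>i\<in>I. s i \<noteq> 0}"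
  have piv: "piv I s \<in> I \<and> s (piv I s) \<noteq> 0" if "\<exists>i\<in>I. s i \<noteq> 0" for I s
    unfolding piv_def using that by (metis (mono_tags, lifting) someI_ex)
  have "finite \<A>'"
    unfolding \<A>'_def using insert.prems(1) by (auto intro: finite_subset)
  moreover have "finite I' \<and> card I' \<le> card K" if el: "(I', s', p') \<in> \<A>'" for I' s' p'
  proof -
    obtain I s p where "(I, s, p) \<in> \<A>" "\<exists>i\<in>I. s i \<noteq> 0" "I' = I - {piv I s}"
      using el unfolding \<A>'_def elim_def by auto
    then show ?thesis
      using piv insert.prems(2) insert.hyps by fastforce
  qed
  ultimately obtain t where t: "\<forall>l\<in>K. 0 < t l \<and> t l < \<epsilon>"
    and tno: "\<And>I s p c. (I, s, p) \<in> \<A>' \<Longrightarrow> (\<Sum>i\<in>I. c i * s i) = 1 \<Longrightarrow>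
        \<exists>l\<in>K. (\<Sum>i\<in>I. c i * p i l) \<noteq> t l"
    using insert.IH[of \<A>'] insert.prems(3) by blast
  let ?t = "t(k := \<tau>)"
  have "\<exists>l\<in>insert k K. (\<Sum>i\<in>I. c i * p i l) \<noteq> ?t l"
    if A: "(I, s, p) \<in> \<A>" and s1: "(\<Sum>i\<in>I. c i * s i) = 1" for I s p c
  proof (rule ccontr)
    assume "\<not> ?thesis"
    then have sol: "\<forall>l\<in>K. (\<Sum>i\<in>I. c i * p i l) = t l"
      and solk: "(\<Sum>i\<in>I. c i * p i k) = \<tau>"
      using insert.hyps by (auto split: if_splits)
    have "\<exists>i\<in>I. s i \<noteq> 0"
    proof (rule ccontr)
      assume "\<not> ?thesis"
      then have "(\<Sum>i\<in>I. c i * s i) = 0" by simp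
      with s1 show False by simp
    qed
    note pv = piv[OF this]
    have el: "elim (I, s, p) \<in> \<A>'"
      unfolding \<A>'_def using A \<open>\<exists>i\<in>I. s i \<noteq> 0\<close> by auto
    let ?i = "piv I s"
    have "p ?i k / s ?i \<in> B"
      unfolding B_def using A pv by force
    then have nz: "\<psi> s p ?i \<noteq> 0"
      using \<tau>(3) pv unfolding \<psi>_def by (auto simp: field_simps)
    have "finite I" using insert.prems(2)[OF A] by simp
    have "(\<Sum>i\<in>I. c i * \<psi> s p i) = 0"
      unfolding \<psi>_def using solk s1
      by (simp add: algebra_simps sum_subtractf sum_distrib_left[symmetric])
    then have cz: "c ?i * \<psi> s p ?i + (\<Sum>i\<in>I - {?i}. c i * \<psi> s p i) = 0"
      using sum.remove[OF \<open>finite I\<close>, of ?i] pv by metis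
    have key: "(\<Sum>i\<in>I - {?i}. c i * (q i - \<psi> s p i / \<psi> s p ?i * q ?i)) = (\<Sum>i\<in>I. c i * q i)" for q
    proof -
      have "(\<Sum>i\<in>I - {?i}. c i * (q i - \<psi> s p i / \<psi> s p ?i * q ?i))
          = (\<Sum>i\<in>I - {?i}. c i * q i) - (\<Sum>i\<in>I - {?i}. c i * \<psi> s p i) * (q ?i / \<psi> s p ?i)"
        by (simp add: algebra_simps sum_subtractf sum_distrib_left sum_distrib_right)
      also have "(\<Sum>i\<in>I - {?i}. c i * \<psi> s p i) = - (c ?i * \<psi> s p ?i)"
        using cz by simp
      also have "(\<Sum>i\<in>I - {?i}. c i * q i) - - (c ?i * \<psi> s p ?i) * (q ?i / \<psi> s p ?i)
          = c ?i * q ?i + (\<Sum>i\<in>I - {?i}. c i * q i)"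
        using nz by simp
      finally show ?thesis
        using sum.remove[OF \<open>finite I\<close>, of ?i "\<lambda>i. c i * q i"] pv by simp
    qed
    have "(\<Sum>i\<in>I - {?i}. c i * (p i l - \<psi> s p i / \<psi> s p ?i * p ?i l)) = (\<Sum>i\<in>I. c i * p i l)" for l
      by (rule key)
    then show False
      using tno[OF el[unfolded elim_def prod.case], of c] s1 sol key[of s] by auto
  qed
  moreover have "\<forall>l\<in>insert k K. 0 < ?t l \<and> ?t l < \<epsilon>"
    using t \<tau> by auto
  ultimately show ?case by blast
qed

text \<open>The centres of the stars are a minimal dominating set or its complement, which also dominates.\<close>

lemma spanning_star_forest:
  assumes "finite V"
    and nbr: "\<And>v. v \<in> V \<Longrightarrow> \<exists>w\<in>V. w \<noteq> v \<and> E v w"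
    and sym: "\<And>v w. E v w \<Longrightarrow> E w v"
  obtains L c where "L \<subseteq> V" "\<And>v. v \<in> L \<Longrightarrow> c v \<in> V - L \<and> E v (c v)" "card V \<le> 2 * card L"
proof -
  define dom where "dom D \<longleftrightarrow> D \<subseteq> V \<and> (\<forall>v\<in>V - D. \<exists>w\<in>D. E v w)" for D
  have "dom V" unfolding dom_def by blast
  then obtain D where D: "dom D" and min: "\<And>D'. dom D' \<Longrightarrow> card D \<le> card D'"
    using ex_has_least_nat[of dom V card] by blast
  have fD: "finite D" using D \<open>finite V\<close> unfolding dom_def by (auto intro: finite_subset)
  have "dom (V - D)"
    unfolding dom_def
  proof (intro conjI ballI)
    fix v assume v: "v \<in> V - (V - D)"
    \<comment> \<open>By minimality some vertex is no longer dominated once \<open>v\<close> leaves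
      \<open>D\<close>: either \<open>v\<close> itself, whose neighbours other than itself then lie
      outside \<open>D\<close>, or some \<open>u\<close> outside \<open>D\<close> whose only
      neighbour in \<open>D\<close> is \<open>v\<close>. Both give \<open>v\<close> a neighbour in
      \<open>V - D\<close>.\<close>
    have "\<not> dom (D - {v})"
    proof
      assume "dom (D - {v})"
      from min[OF this] show False
        using v fD card_Diff1_less[of D v] by simp
    qed
    then obtain u where u: "u \<in> V" "u = v \<or> u \<notin> D" "\<And>w. w \<in> D - {v} \<Longrightarrow> \<not> E u w"
      using D unfolding dom_def by auto
    show "\<exists>w\<in>V - D. E v w"
    proof (cases "u = v")
      case True
      with nbr[of v] u v show ?thesis by blast
    next
      case False
      with D u sym show ?thesis unfolding dom_def by blast
    qed
  qed auto
  have sum: "card V = card D + card (V - D)"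
    using D fD \<open>finite V\<close> unfolding dom_def by (metis card_Diff_subset card_mono le_add_diff_inverse)
  \<comment> \<open>The smaller of \<open>D\<close> and \<open>V - D\<close> supplies the centres,
    so the leaves make up at least half of \<open>V\<close>.\<close>
  have ex: "\<exists>D'. dom D' \<and> card V \<le> 2 * card (V - D')"
  proof (cases "card D \<le> card (V - D)")
    case True
    with D sum show ?thesis by (intro exI[of _ D]) auto
  next
    case False
    moreover have "V - (V - D) = D" using D unfolding dom_def by auto
    ultimately show ?thesis
      using \<open>dom (V - D)\<close> sum by (intro exI[of _ "V - D"]) auto
  qed
  then obtain D' where D': "dom D'" "card V \<le> 2 * card (V - D')" by blast
  then obtain c where "\<forall>v\<in>V - D'. c v \<in> D' \<and> E v (c v)"
    unfolding dom_def by metis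
  with D' show thesis
    unfolding dom_def by (intro that[of "V - D'" c]) auto
qed

section \<open>Covering dimension and simplicial approximation\<close>

lemma covering_dim_lessE:
  assumes "covering_dim T < c"
  obtains n where "covering_dim_le T n" "ereal (real_of_int n) < c"
  using assms unfolding covering_dim_def Inf_less_iff by auto

text \<open>Supplies the dimension of the one-point block that fills the second slot when a pair is
  determined by its first point.\<close>

lemma covering_dim_le_singleton:
  assumes "topspace T = {x}"
  shows "covering_dim_le T 0"
  unfolding covering_dim_le_def
proof (intro allI impI)
  fix \<U> assume \<U>: "finite_open_cover T \<U>"
  then have "x \<in> \<Union>\<U>" using assms unfolding finite_open_cover_def by simp
  moreover have "openin T {x}" using assms openin_topspace[of T] by simp
  ultimately show "\<exists>\<V>. finite_open_cover T \<V> \<and> refines \<V> \<U> \<and>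
      (\<forall>x\<in>topspace T. int (card {V \<in> \<V>. x \<in> V}) \<le> 0 + 1)"
    using assms by (intro exI[of _ "{{x}}"]) (auto simp: finite_open_cover_def Defs.refines_def Collect_conv_if)
qed

text \<open>The sets of a cover of \<open>C\<close> extend to open sets of \<open>T\<close>;
  together with the complement of \<open>C\<close>, open because \<open>C\<close> is closed, they
  cover \<open>T\<close>. A refinement taken in \<open>T\<close> is then restricted to
  \<open>C\<close>, which does not raise the number of members through a point.\<close>

lemma covering_dim_le_closed_subset:
  assumes dim: "covering_dim_le T n" and C: "closedin T C"
  shows "covering_dim_le (subtopology T C) n"
  unfolding covering_dim_le_def
proof (intro allI impI)
  fix \<U> assume \<U>: "finite_open_cover (subtopology T C) \<U>"
  have top: "topspace (subtopology T C) = C"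
    using C by (simp add: closedin_subset inf.absorb2)
  have "\<forall>U\<in>\<U>. \<exists>W. openin T W \<and> U = W \<inter> C"
    using \<U> unfolding finite_open_cover_def openin_subtopology by auto
  then obtain W where W: "\<And>U. U \<in> \<U> \<Longrightarrow> openin T (W U) \<and> U = W U \<inter> C" by metis
  have "finite_open_cover T (insert (topspace T - C) (W ` \<U>))"
    unfolding finite_open_cover_def
  proof (intro conjI ballI)
    show "finite (insert (topspace T - C) (W ` \<U>))"
      using \<U> unfolding finite_open_cover_def by simp
    show "openin T U" if "U \<in> insert (topspace T - C) (W ` \<U>)" for U
      using that W C by auto
    have "C \<subseteq> \<Union>(W ` \<U>)"
      using \<U> W top unfolding finite_open_cover_def by fastforce
    moreover have "\<Union>(W ` \<U>) \<subseteq> topspace T"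
      using W openin_subset by fastforce
    ultimately show "\<Union>(insert (topspace T - C) (W ` \<U>)) = topspace T"
      by auto
  qed
  then obtain \<V> where \<V>: "finite_open_cover T \<V>" "Defs.refines \<V> (insert (topspace T - C) (W ` \<U>))"
    "\<And>x. x \<in> topspace T \<Longrightarrow> int (card {V\<in>\<V>. x \<in> V}) \<le> n + 1"
    using dim unfolding covering_dim_le_def by blast
  \<comment> \<open>Members of the refinement inside the complement of \<open>C\<close> leave only
    the empty trace. Once it is discarded, every trace comes from a member inside some
    \<open>W U\<close>.\<close>
  define \<V>' where "\<V>' = (\<lambda>V. V \<inter> C) ` \<V> - {{}}"
  have "finite_open_cover (subtopology T C) \<V>'"
    unfolding finite_open_cover_def
  proof (intro conjI ballI)
    show "finite \<V>'" using \<V> unfolding \<V>'_def finite_open_cover_def by simp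
    show "openin (subtopology T C) U" if "U \<in> \<V>'" for U
      using that \<V>(1) unfolding \<V>'_def finite_open_cover_def by (auto intro: openin_subtopology_Int)
    have "\<Union>\<V>' = \<Union>\<V> \<inter> C" unfolding \<V>'_def by auto
    also have "\<Union>\<V> = topspace T" using \<V>(1) unfolding finite_open_cover_def by auto
    finally show "\<Union>\<V>' = topspace (subtopology T C)" by simp
  qed
  moreover have "Defs.refines \<V>' \<U>"
    unfolding Defs.refines_def
  proof
    fix V' assume "V' \<in> \<V>'"
    then have "V' \<in> (\<lambda>V. V \<inter> C) ` \<V>" "V' \<noteq> {}" unfolding \<V>'_def by simp_all
    then obtain V where V: "V' = V \<inter> C" "V \<in> \<V>" by (elim imageE)
    have "\<exists>U\<in>insert (topspace T - C) (W ` \<U>). V \<subseteq> U"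
      using \<V>(2) V(2) unfolding Defs.refines_def by (rule bspec)
    then have "V \<subseteq> topspace T - C \<or> (\<exists>U\<in>\<U>. V \<subseteq> W U)" by simp
    moreover have "\<not> V \<subseteq> topspace T - C" using V(1) \<open>V' \<noteq> {}\<close> by blast
    ultimately obtain U' where "U' \<in> \<U>" "V \<subseteq> W U'" by blast
    with V(1) W show "\<exists>U\<in>\<U>. V' \<subseteq> U" by blast
  qed
  moreover have "int (card {V\<in>\<V>'. x \<in> V}) \<le> n + 1" if "x \<in> topspace (subtopology T C)" for x
  proof -
    have "{V\<in>\<V>'. x \<in> V} \<subseteq> (\<lambda>V. V \<inter> C) ` {V\<in>\<V>. x \<in> V}" unfolding \<V>'_def by auto
    moreover have fin: "finite {V\<in>\<V>. x \<in> V}" using \<V>(1) unfolding finite_open_cover_def by simp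
    ultimately have "card {V\<in>\<V>'. x \<in> V} \<le> card {V\<in>\<V>. x \<in> V}"
      by (meson card_image_le card_mono finite_imageI order_trans)
    then show ?thesis using \<V>(3)[of x] that by simp
  qed
  ultimately show "\<exists>\<V>. finite_open_cover (subtopology T C) \<V> \<and> refines \<V> \<U> \<and>
      (\<forall>x\<in>topspace (subtopology T C). int (card {V \<in> \<V>. x \<in> V}) \<le> n + 1)"
    by blast
qed

text \<open>The infimum is capped at \<open>1\<close> so that it is not taken over the empty set when \<open>V = topspace T\<close>.\<close>

lemma metrizable_openin_cozero:
  assumes "metrizable_space T" "openin T V"
  obtains w :: "'a \<Rightarrow> real" where "continuous_map T euclideanreal w"
    "\<And>x. x \<in> topspace T \<Longrightarrow> 0 \<le> w x" "\<And>x. x \<in> topspace T \<Longrightarrow> w x \<noteq> 0 \<longleftrightarrow> x \<in> V"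
proof -
  obtain M d where "Metric_space M d" and T: "T = Metric_space.mtopology M d"
    using assms(1) unfolding metrizable_space_def by blast
  then interpret Metric_space M d by simp
  define w where "w x = Inf (insert 1 (d x ` (M - V)))" for x
  have bdd: "bdd_below (insert 1 (d x ` (M - V)))" for x
    by (rule bdd_belowI[of _ 0]) auto
  have nonneg: "0 \<le> w x" for x
    unfolding w_def by (rule cInf_greatest) auto
  have lip: "w x \<le> w y + d x y" if "x \<in> M" "y \<in> M" for x y
  proof -
    have "w x - d x y \<le> w y"
      unfolding w_def[of y]
    proof (rule cInf_greatest)
      fix t assume "t \<in> insert 1 (d y ` (M - V))"
      then consider "t = 1" | z where "z \<in> M" "z \<notin> V" "t = d y z" by auto
      then show "w x - d x y \<le> t"
      proof cases
        case 1
        have "w x \<le> 1" unfolding w_def by (rule cInf_lower[OF _ bdd]) auto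
        then show ?thesis using 1 nonneg[of x] Metric_space.nonneg[OF \<open>Metric_space M d\<close>, of x y] by linarith
      next
        case 2
        have "w x \<le> d x z" unfolding w_def by (rule cInf_lower[OF _ bdd]) (use 2 in auto)
        also have "\<dots> \<le> d x y + d y z" using that 2 triangle by blast
        finally show ?thesis using 2 by simp
      qed
    qed auto
    then show ?thesis by simp
  qed
  show thesis
  proof
    have "Lipschitz_continuous_map (metric (M,d)) euclidean_metric w"
      unfolding Lipschitz_continuous_map_def
    proof (intro conjI exI[of _ 1] ballI)
      fix x y assume "x \<in> mspace (metric (M, d))" "y \<in> mspace (metric (M, d))"
      then show "mdist euclidean_metric (w x) (w y) \<le> 1 * mdist (metric (M, d)) x y"
        using lip[of x y] lip[of y x] by (simp add: dist_real_def commute abs_le_iff)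
    qed auto
    then show "continuous_map T euclideanreal w"
      using Lipschitz_continuous_imp_continuous_map[of "metric (M,d)" euclidean_metric w] by (simp add: T)
    show "0 \<le> w x" for x by (rule nonneg)
    show "w x \<noteq> 0 \<longleftrightarrow> x \<in> V" if "x \<in> topspace T" for x
    proof
      assume "w x \<noteq> 0"
      show "x \<in> V"
      proof (rule ccontr)
        assume "x \<notin> V"
        moreover have "x \<in> M" using that T by simp
        ultimately have "d x x \<in> insert 1 (d x ` (M - V))" by (intro insertI2 imageI DiffI)
        then have "w x \<le> d x x"
          unfolding w_def by (intro cInf_lower[OF _ bdd])
        with \<open>w x \<noteq> 0\<close> nonneg[of x] that T show False by simp
      qed
    next
      assume "x \<in> V"
      then obtain r where r: "r > 0" "mball x r \<subseteq> V"
        using assms(2) unfolding T openin_mtopology by blast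
      have "min r 1 \<le> w x"
        unfolding w_def
      proof (rule cInf_greatest)
        fix t assume "t \<in> insert 1 (d x ` (M - V))"
        then consider "t = 1" | z where "z \<in> M" "z \<notin> V" "t = d x z" by auto
        then show "min r 1 \<le> t"
        proof cases
          case 2
          then have "z \<notin> mball x r" using r by auto
          then show ?thesis using 2 that T by auto
        qed auto
      qed auto
      with r show "w x \<noteq> 0" by auto
    qed
  qed
qed

text \<open>\<open>I\<close> is a refinement of a cover by sets on which each \<open>F k\<close>
  oscillates by less than \<open>\<epsilon>\<close>, and \<open>\<psi>\<close> is a partition of
  unity built on it: the barycentric coordinates of a map to the nerve, whose dimension is at most
  \<open>n\<close>. With one sample point \<open>\<xi> i\<close> per vertex,
  \<open>\<Sum>i\<in>I. \<psi> i x * F k (\<xi> i)\<close> approximates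
  \<open>F k x\<close>.\<close>

lemma simplicial_approximation:
  fixes F :: "'k \<Rightarrow> 'a \<Rightarrow> real"
  assumes met: "metrizable_space T" and comp: "compact_space T" and dim: "covering_dim_le T n"
    and "finite K" and F: "\<And>k. k \<in> K \<Longrightarrow> continuous_map T euclideanreal (F k)" and "\<epsilon> > 0"
  obtains I :: "'a set set" and \<psi> :: "'a set \<Rightarrow> 'a \<Rightarrow> real" and \<xi> :: "'a set \<Rightarrow> 'a" where
    "finite I" "\<And>i. i \<in> I \<Longrightarrow> \<xi> i \<in> topspace T"
    "\<And>i. i \<in> I \<Longrightarrow> continuous_map T euclideanreal (\<psi> i)"
    "\<And>i x. i \<in> I \<Longrightarrow> x \<in> topspace T \<Longrightarrow> 0 \<le> \<psi> i x"
    "\<And>x. x \<in> topspace T \<Longrightarrow> (\<Sum>i\<in>I. \<psi> i x) = 1"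
    "\<And>x. x \<in> topspace T \<Longrightarrow> int (card {i\<in>I. \<psi> i x \<noteq> 0}) \<le> n + 1"
    "\<And>x i k. x \<in> topspace T \<Longrightarrow> i \<in> I \<Longrightarrow> k \<in> K \<Longrightarrow> \<psi> i x \<noteq> 0 \<Longrightarrow> \<bar>F k (\<xi> i) - F k x\<bar> < \<epsilon>"
proof -
  \<comment> \<open>Half of \<open>\<epsilon>\<close>, because two points of one member are compared
    through the centre \<open>x\<close>.\<close>
  define N where "N x = {z \<in> topspace T. \<forall>k\<in>K. \<bar>F k z - F k x\<bar> < \<epsilon>/2}" for x
  have N_open: "openin T (N x)" for x
  proof -
    have "openin T {z \<in> topspace T. F k z \<in> ball (F k x) (\<epsilon>/2)}" if "k \<in> K" for k
      using F[OF that] by (intro openin_continuous_map_preimage) auto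
    moreover have "N x = topspace T \<inter> (\<Inter>k\<in>K. {z \<in> topspace T. F k z \<in> ball (F k x) (\<epsilon>/2)})"
      unfolding N_def by (auto simp: dist_real_def abs_minus_commute)
    ultimately show ?thesis
      using openin_INT[OF \<open>finite K\<close>, of T "\<lambda>k. {z \<in> topspace T. F k z \<in> ball (F k x) (\<epsilon>/2)}"]
      by (simp only: Int_commute)
  qed
  have "\<exists>\<F>. finite \<F> \<and> \<F> \<subseteq> N ` topspace T \<and> topspace T \<subseteq> \<Union>\<F>"
  proof -
    have "topspace T \<subseteq> \<Union>(N ` topspace T)" unfolding N_def using \<open>\<epsilon> > 0\<close> by auto
    then show ?thesis
      using compactinD[of T "topspace T" "N ` topspace T"] comp N_open
      unfolding compact_space_def by blast
  qed
  then obtain \<F> where \<F>: "finite \<F>" "\<F> \<subseteq> N ` topspace T" "topspace T \<subseteq> \<Union>\<F>" by blast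
  have "finite_open_cover T \<F>"
    unfolding finite_open_cover_def using \<F> N_open by (auto simp: N_def)
  then obtain \<V> where \<V>: "finite_open_cover T \<V>" "Defs.refines \<V> \<F>"
    "\<And>x. x \<in> topspace T \<Longrightarrow> int (card {V\<in>\<V>. x \<in> V}) \<le> n + 1"
    using dim unfolding covering_dim_le_def by blast
  \<comment> \<open>The empty set is removed so that every index contains a point to serve as
    \<open>\<xi> i\<close>.\<close>
  define I where "I = \<V> - {{}}"
  have fin: "finite I" using \<V>(1) unfolding I_def finite_open_cover_def by simp
  have opn: "openin T i" if "i \<in> I" for i using that \<V>(1) unfolding I_def finite_open_cover_def by auto
  have cov: "\<exists>i\<in>I. x \<in> i" if "x \<in> topspace T" for x
    using that \<V>(1) unfolding I_def finite_open_cover_def by auto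
  have osc: "\<bar>F k z - F k x\<bar> < \<epsilon>" if "i \<in> I" "x \<in> i" "z \<in> i" "k \<in> K" for i x z k
  proof -
    have "i \<in> \<V>" using that(1) unfolding I_def by simp
    then obtain f where "f \<in> \<F>" "i \<subseteq> f"
      using \<V>(2) unfolding Defs.refines_def by metis
    then obtain y where "y \<in> topspace T" "i \<subseteq> N y"
      using \<F>(2) by auto
    then have "\<bar>F k x - F k y\<bar> < \<epsilon>/2" "\<bar>F k z - F k y\<bar> < \<epsilon>/2"
      using that unfolding N_def by auto
    then show ?thesis by argo
  qed
  have "\<forall>i\<in>I. \<exists>w. continuous_map T euclideanreal w \<and> (\<forall>x\<in>topspace T. 0 \<le> w x \<and> (w x \<noteq> 0 \<longleftrightarrow> x \<in> i))"
  proof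
    fix i assume "i \<in> I"
    obtain w :: "'a \<Rightarrow> real" where "continuous_map T euclideanreal w" "\<And>x. x \<in> topspace T \<Longrightarrow> 0 \<le> w x"
        "\<And>x. x \<in> topspace T \<Longrightarrow> w x \<noteq> 0 \<longleftrightarrow> x \<in> i"
      using metrizable_openin_cozero[OF met opn[OF \<open>i \<in> I\<close>]] by blast
    then show "\<exists>w. continuous_map T euclideanreal w \<and> (\<forall>x\<in>topspace T. 0 \<le> w x \<and> (w x \<noteq> 0 \<longleftrightarrow> x \<in> i))"
      by blast
  qed
  then obtain w where w: "\<And>i. i \<in> I \<Longrightarrow> continuous_map T euclideanreal (w i)"
    "\<And>i x. i \<in> I \<Longrightarrow> x \<in> topspace T \<Longrightarrow> 0 \<le> w i x"
    "\<And>i x. i \<in> I \<Longrightarrow> x \<in> topspace T \<Longrightarrow> w i x \<noteq> 0 \<longleftrightarrow> x \<in> i" by metis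
  define W where "W x = (\<Sum>i\<in>I. w i x)" for x
  have Wpos: "W x > 0" if x: "x \<in> topspace T" for x
  proof -
    obtain i where "i \<in> I" "x \<in> i" using cov x by blast
    then have "0 < w i x" using w(2,3)[of i x] x by linarith
    then show ?thesis
      unfolding W_def using \<open>i \<in> I\<close> w(2) x by (intro sum_pos2[OF fin]) auto
  qed
  have Wcont: "continuous_map T euclideanreal W"
    unfolding W_def using w(1) by (intro continuous_map_sum[OF fin])
  show thesis
  proof
    show "finite I" by (rule fin)
    show "(SOME z. z \<in> i) \<in> topspace T" if "i \<in> I" for i
    proof -
      have "i \<noteq> {}" using that unfolding I_def by blast
      then show ?thesis using openin_subset[OF opn[OF that]] some_in_eq by blast
    qed
    show "continuous_map T euclideanreal (\<lambda>x. w i x / W x)" if "i \<in> I" for i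
      using that w(1) Wcont Wpos by (intro continuous_map_real_divide) force+
    show "0 \<le> w i x / W x" if "i \<in> I" "x \<in> topspace T" for i x
      using that w(2) Wpos by (simp add: less_imp_le)
    show "(\<Sum>i\<in>I. w i x / W x) = 1" if "x \<in> topspace T" for x
      using Wpos[OF that] by (simp add: sum_divide_distrib[symmetric] W_def)
    show "int (card {i\<in>I. w i x / W x \<noteq> 0}) \<le> n + 1" if x: "x \<in> topspace T" for x
    proof -
      have "{i\<in>I. w i x / W x \<noteq> 0} \<subseteq> {V\<in>\<V>. x \<in> V}"
        using w(3) x unfolding I_def by auto
      then have "card {i\<in>I. w i x / W x \<noteq> 0} \<le> card {V\<in>\<V>. x \<in> V}"
        using \<V>(1) unfolding finite_open_cover_def by (intro card_mono) auto
      then show ?thesis using \<V>(3)[OF x] by linarith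
    qed
    show "\<bar>F k (SOME z. z \<in> i) - F k x\<bar> < \<epsilon>"
      if "x \<in> topspace T" "i \<in> I" "k \<in> K" "w i x / W x \<noteq> 0" for x i k
    proof -
      have "x \<in> i" using that w(3) by auto
      then show ?thesis using osc[OF that(2) _ _ that(3)] by (metis someI[of "\<lambda>z. z \<in> i"])
    qed
  qed
qed

section \<open>Perturbing a function on disjoint blocks\<close>

text \<open>
  The two relations \<open>\<Sum>i. \<psi> b i = 1\<close> are merged into one by basing the second simplex at one of its
  vertices; this saves the dimension that makes the strict inequality on \<open>m\<close> sufficient.
\<close>

lemma avoid_simplex_differences:
  fixes A :: "bool \<Rightarrow> 'i \<Rightarrow> 'k \<Rightarrow> real" and I :: "bool \<Rightarrow> 'i set" and m :: "bool \<Rightarrow> int"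
  assumes "finite K" and fin: "\<And>b. finite (I b)" and m: "m True + m False < int (card K)" and "\<epsilon> > 0"
  obtains t where "\<forall>k\<in>K. 0 < t k \<and> t k < \<epsilon>"
    "\<forall>\<psi>. (\<forall>b. (\<Sum>i\<in>I b. \<psi> b i) = 1 \<and> int (card {i\<in>I b. \<psi> b i \<noteq> 0}) \<le> m b + 1) \<longrightarrow>
      (\<exists>k\<in>K. (\<Sum>i\<in>I True. \<psi> True i * A True i k) + (\<Sum>i\<in>I False. \<psi> False i * A False i k) \<noteq> t k)"
proof -
  \<comment> \<open>One system for a face \<open>J\<close> of the first simplex, a face
    \<open>J'\<close> of the second and a base vertex \<open>j\<close> of \<open>J'\<close>.
    Relative to \<open>j\<close> the second point has free coordinates on \<open>J' - {j}\<close>;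
    the constant \<open>A False j k\<close> is absorbed into the first sum, whose coefficients add
    up to \<open>1\<close>. This last relation is the normalisation, hence \<open>s\<close> is
    \<open>1\<close> on the left and \<open>0\<close> on the right.\<close>
  define fam where "fam = (\<lambda>(J :: 'i set, J' :: 'i set, j). (Inl ` J \<union> Inr ` (J' - {j}),
      case_sum (\<lambda>_::'i. 1::real) (\<lambda>_::'i. 0),
      case_sum (\<lambda>i k. A True i k + A False j k) (\<lambda>i k. A False i k - A False j k)))"
  define P where "P = {(J, J', j). J \<subseteq> I True \<and> J' \<subseteq> I False \<and> j \<in> J' \<and>
      int (card J) \<le> m True + 1 \<and> int (card J') \<le> m False + 1}"
  have "P \<subseteq> Pow (I True) \<times> Pow (I False) \<times> I False" unfolding P_def by auto
  then have "finite P" by (rule finite_subset) (simp add: fin)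
  \<comment> \<open>The unknowns number at most \<open>(m True + 1) + (m False + 1) - 1\<close>, and
    the strict bound on \<open>m True + m False\<close> makes this at most
    \<open>card K\<close>.\<close>
  have size: "finite D \<and> card D \<le> card K" if D: "(D, s, p) \<in> fam ` P" for D s p
  proof -
    obtain J J' j where J: "(J, J', j) \<in> P" "D = Inl ` J \<union> Inr ` (J' - {j})"
      using D unfolding fam_def by auto
    then have fJ: "finite J" "finite J'"
      using fin unfolding P_def by (auto intro: finite_subset)
    have "card D = card J + card (J' - {j})"
      unfolding J(2) using fJ by (subst card_Un_disjoint) (auto simp: card_image)
    moreover have "card (J' - {j}) = card J' - 1" using J(1) fJ unfolding P_def by simp
    moreover have "card J' > 0" using J(1) fJ unfolding P_def by (auto simp: card_gt_0_iff)
    ultimately have "int (card D) = int (card J) + int (card J') - 1" by linarith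
    then show ?thesis using J(1) m fJ J(2) unfolding P_def by auto
  qed
  obtain t where t: "\<forall>k\<in>K. 0 < t k \<and> t k < \<epsilon>"
    and no: "\<And>D s p c. (D, s, p) \<in> fam ` P \<Longrightarrow> (\<Sum>i\<in>D. c i * s i) = 1 \<Longrightarrow> \<exists>k\<in>K. (\<Sum>i\<in>D. c i * p i k) \<noteq> t k"
    using avoid_affine_solutions[of K "fam ` P" \<epsilon>] \<open>finite K\<close> \<open>finite P\<close> size \<open>\<epsilon> > 0\<close> by blast
  show thesis
  proof (rule that[OF t], intro allI impI)
    fix \<psi> :: "bool \<Rightarrow> 'i \<Rightarrow> real"
    assume "\<forall>b. (\<Sum>i\<in>I b. \<psi> b i) = 1 \<and> int (card {i\<in>I b. \<psi> b i \<noteq> 0}) \<le> m b + 1"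
    then have one: "\<And>b. (\<Sum>i\<in>I b. \<psi> b i) = 1"
      and small: "\<And>b. int (card {i\<in>I b. \<psi> b i \<noteq> 0}) \<le> m b + 1" by auto
    define J where "J b = {i\<in>I b. \<psi> b i \<noteq> 0}" for b
    have restr: "(\<Sum>i\<in>I b. \<psi> b i * q i) = (\<Sum>i\<in>J b. \<psi> b i * q i)" for b q
      unfolding J_def by (rule sum.mono_neutral_right) (auto simp: fin)
    have J1: "(\<Sum>i\<in>J b. \<psi> b i) = 1" for b using one[of b] restr[of b "\<lambda>_. 1"] by simp
    then obtain j where j: "j \<in> J False" by (metis ex_in_conv sum.empty zero_neq_one)
    have fJ: "finite (J b)" for b unfolding J_def using fin by simp
    have "(J True, J False, j) \<in> P"
      unfolding P_def using small j by (auto simp: J_def)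
    then have mem: "(Inl ` J True \<union> Inr ` (J False - {j}), case_sum (\<lambda>_. 1) (\<lambda>_. 0),
        case_sum (\<lambda>i k. A True i k + A False j k) (\<lambda>i k. A False i k - A False j k)) \<in> fam ` P"
      by (rule image_eqI[rotated]) (simp add: fam_def)
    define c where "c = case_sum (\<psi> True) (\<psi> False)"
    have split: "(\<Sum>i\<in>Inl ` J True \<union> Inr ` (J False - {j}). c i * r i)
        = (\<Sum>i\<in>J True. \<psi> True i * r (Inl i)) + (\<Sum>i\<in>J False - {j}. \<psi> False i * r (Inr i))" for r
      using fJ by (subst sum.union_disjoint) (auto simp: sum.reindex c_def)
    \<comment> \<open>The term at \<open>j\<close> is zero, so the base vertex may be put back into
      the sum.\<close>
    have ext: "(\<Sum>i\<in>J False - {j}. \<psi> False i * (q i - q j)) = (\<Sum>i\<in>J False. \<psi> False i * (q i - q j))" for q :: "'i \<Rightarrow> real"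
      using sum.remove[OF fJ j, of "\<lambda>i. \<psi> False i * (q i - q j)"] by simp
    have "\<exists>k\<in>K. (\<Sum>i\<in>Inl ` J True \<union> Inr ` (J False - {j}). c i *
        (case_sum (\<lambda>i k. A True i k + A False j k) (\<lambda>i k. A False i k - A False j k)) i k) \<noteq> t k"
      using mem by (rule no) (simp add: split J1)
    moreover have "(\<Sum>i\<in>Inl ` J True \<union> Inr ` (J False - {j}). c i *
        (case_sum (\<lambda>i k. A True i k + A False j k) (\<lambda>i k. A False i k - A False j k)) i k)
      = (\<Sum>i\<in>I True. \<psi> True i * A True i k) + (\<Sum>i\<in>I False. \<psi> False i * A False i k)" for k
    proof -
      have "(\<Sum>i\<in>Inl ` J True \<union> Inr ` (J False - {j}). c i *
          (case_sum (\<lambda>i k. A True i k + A False j k) (\<lambda>i k. A False i k - A False j k)) i k)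
        = (\<Sum>i\<in>J True. \<psi> True i * (A True i k + A False j k))
          + (\<Sum>i\<in>J False. \<psi> False i * (A False i k - A False j k))"
        using ext[of "\<lambda>i. A False i k"] by (simp add: split)
      also have "\<dots> = (\<Sum>i\<in>J True. \<psi> True i * A True i k) + (\<Sum>i\<in>J True. \<psi> True i) * A False j k
          + (\<Sum>i\<in>J False. \<psi> False i * A False i k) - (\<Sum>i\<in>J False. \<psi> False i) * A False j k"
        by (simp add: algebra_simps sum.distrib sum_subtractf sum_distrib_left)
      finally show ?thesis by (simp add: J1 restr)
    qed
    ultimately show "\<exists>k\<in>K. (\<Sum>i\<in>I True. \<psi> True i * A True i k) + (\<Sum>i\<in>I False. \<psi> False i * A False i k) \<noteq> t k"
      by simp
  qed
qed

text \<open>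
  The Boolean \<open>pos v\<close> tells whether the vertex \<open>v\<close> is a translate of the first or of the second
  point of a pair.
\<close>

lemma generic_perturbation:
  fixes T :: "'a topology" and f :: "'r::finite \<Rightarrow> 'a \<Rightarrow> real"
    and pos :: "'v \<Rightarrow> bool" and \<pi> \<rho> :: "'v \<Rightarrow> 'a \<Rightarrow> 'a"
    and C :: "bool \<Rightarrow> 'a set" and n :: "bool \<Rightarrow> int"
  assumes met: "metrizable_space T" and comp: "compact_space T"
    and C: "\<And>b. closedin T (C b)" and dim: "\<And>b. covering_dim_le (subtopology T (C b)) (n b)"
    and "finite V"
    and \<pi>: "\<And>v. v \<in> V \<Longrightarrow> continuous_map T T (\<pi> v)" and \<rho>: "\<And>v. v \<in> V \<Longrightarrow> continuous_map T T (\<rho> v)"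
    and inv: "\<And>v x. v \<in> V \<Longrightarrow> x \<in> topspace T \<Longrightarrow> \<rho> v (\<pi> v x) = x"
    and disj: "\<And>v w. v \<in> V \<Longrightarrow> w \<in> V \<Longrightarrow> v \<noteq> w \<Longrightarrow> \<pi> v ` C (pos v) \<inter> \<pi> w ` C (pos w) = {}"
    and nbr: "\<And>v. v \<in> V \<Longrightarrow> \<exists>w\<in>V. w \<noteq> v \<and> E v w" and sym: "\<And>v w. E v w \<Longrightarrow> E w v"
    and size: "2 * (n True + n False) < int (CARD('r) * card V)"
    and f: "\<And>l. continuous_map T euclideanreal (f l)"
    and f01: "\<And>l x. x \<in> topspace T \<Longrightarrow> 0 \<le> f l x \<and> f l x \<le> 1"
    and "\<epsilon> > 0"
  obtains f' :: "'r \<Rightarrow> 'a \<Rightarrow> real" where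
    "\<And>l. continuous_map T euclideanreal (f' l)"
    "\<And>l x. x \<in> topspace T \<Longrightarrow> 0 \<le> f' l x \<and> f' l x \<le> 1"
    "\<And>l x. x \<in> topspace T \<Longrightarrow> \<bar>f' l x - f l x\<bar> < \<epsilon>"
    "\<And>x. \<forall>b. x b \<in> C b \<Longrightarrow>
      \<exists>v\<in>V. \<exists>w\<in>V. E v w \<and> (\<exists>l. f' l (\<pi> v (x (pos v))) \<noteq> f' l (\<pi> w (x (pos w))))"
proof -
  \<comment> \<open>Scaling by \<open>1 - \<delta>\<close> leaves room in the unit interval for constants below \<open>\<delta>\<close>.\<close>
  define \<delta> where "\<delta> = min (\<epsilon>/4) 1"
  have \<delta>: "0 < \<delta>" "\<delta> \<le> 1" "3 * \<delta> < \<epsilon>" using \<open>\<epsilon> > 0\<close> unfolding \<delta>_def by auto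
  have top: "topspace (subtopology T (C b)) = C b" for b
    using C[of b] by (simp add: closedin_subset inf.absorb2)
  have CT: "x \<in> topspace T" if "x \<in> C b" for x b using C[of b] that closedin_subset by blast
  \<comment> \<open>The simplicial approximation on \<open>C b\<close> is applied to all functions
    \<open>f l \<circ> \<pi> v\<close> at once, so that a single partition of unity serves every
    translate of the block.\<close>
  define Q where "Q b I \<psi> \<xi> \<longleftrightarrow> finite I \<and> (\<forall>i\<in>I. \<xi> i \<in> C b) \<and>
      (\<forall>i\<in>I. continuous_map (subtopology T (C b)) euclideanreal (\<psi> i)) \<and>
      (\<forall>i\<in>I. \<forall>x\<in>C b. 0 \<le> \<psi> i x) \<and> (\<forall>x\<in>C b. (\<Sum>i\<in>I. \<psi> i x) = 1) \<and>
      (\<forall>x\<in>C b. int (card {i\<in>I. \<psi> i x \<noteq> 0}) \<le> n b + 1) \<and>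
      (\<forall>x\<in>C b. \<forall>i\<in>I. \<forall>v\<in>V. \<forall>l. \<psi> i x \<noteq> 0 \<longrightarrow> \<bar>f l (\<pi> v (\<xi> i)) - f l (\<pi> v x)\<bar> < \<delta>)"
    for b and I :: "'a set set" and \<psi> :: "'a set \<Rightarrow> 'a \<Rightarrow> real" and \<xi> :: "'a set \<Rightarrow> 'a"
  have "\<exists>I \<psi> \<xi>. Q b I \<psi> \<xi>" for b
  proof -
    have 1: "metrizable_space (subtopology T (C b))" using met by (rule metrizable_space_subtopology)
    have 2: "compact_space (subtopology T (C b))"
      using closedin_compact_space[OF comp C] by (rule compact_space_subtopology)
    have 3: "continuous_map (subtopology T (C b)) euclideanreal (case k of (v, l) \<Rightarrow> f l \<circ> \<pi> v)"
      if "k \<in> V \<times> UNIV" for k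
      using that continuous_map_from_subtopology[OF continuous_map_compose[OF \<pi> f]] by auto
    have 4: "finite (V \<times> (UNIV :: 'r set))" using \<open>finite V\<close> by simp
    obtain I :: "'a set set" and \<psi> :: "'a set \<Rightarrow> 'a \<Rightarrow> real" and \<xi> :: "'a set \<Rightarrow> 'a" where
      "finite I" "\<And>i. i \<in> I \<Longrightarrow> \<xi> i \<in> C b"
      "\<And>i. i \<in> I \<Longrightarrow> continuous_map (subtopology T (C b)) euclideanreal (\<psi> i)"
      "\<And>i x. i \<in> I \<Longrightarrow> x \<in> C b \<Longrightarrow> 0 \<le> \<psi> i x"
      "\<And>x. x \<in> C b \<Longrightarrow> (\<Sum>i\<in>I. \<psi> i x) = 1"
      "\<And>x. x \<in> C b \<Longrightarrow> int (card {i\<in>I. \<psi> i x \<noteq> 0}) \<le> n b + 1"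
      "\<And>x i k. x \<in> C b \<Longrightarrow> i \<in> I \<Longrightarrow> k \<in> V \<times> UNIV \<Longrightarrow> \<psi> i x \<noteq> 0 \<Longrightarrow>
        \<bar>(case k of (v, l) \<Rightarrow> f l \<circ> \<pi> v) (\<xi> i) - (case k of (v, l) \<Rightarrow> f l \<circ> \<pi> v) x\<bar> < \<delta>"
      by (rule simplicial_approximation[where F = "\<lambda>k. case k of (v, l) \<Rightarrow> f l \<circ> \<pi> v",
            OF 1 2 dim 4 3 \<open>0 < \<delta>\<close>, unfolded top], assumption) (rule that; assumption)
    then have "Q b I \<psi> \<xi>" unfolding Q_def by force
    then show ?thesis by blast
  qed
  then obtain I \<psi> \<xi> where Q: "\<And>b. Q b (I b) (\<psi> b) (\<xi> b)" by metis
  have finI: "finite (I b)" for b using Q[of b] unfolding Q_def by blast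
  have \<xi>C: "\<xi> b i \<in> C b" if "i \<in> I b" for b i using Q[of b] that unfolding Q_def by blast
  have \<psi>cont: "continuous_map (subtopology T (C b)) euclideanreal (\<psi> b i)" if "i \<in> I b" for b i
    using Q[of b] that unfolding Q_def by blast
  have \<psi>0: "0 \<le> \<psi> b i x" if "i \<in> I b" "x \<in> C b" for b i x using Q[of b] that unfolding Q_def by blast
  have \<psi>1: "(\<Sum>i\<in>I b. \<psi> b i x) = 1" if "x \<in> C b" for b x using Q[of b] that unfolding Q_def by blast
  have \<psi>card: "int (card {i\<in>I b. \<psi> b i x \<noteq> 0}) \<le> n b + 1" if "x \<in> C b" for b x
    using Q[of b] that unfolding Q_def by blast
  have \<psi>near: "\<bar>f l (\<pi> v (\<xi> b i)) - f l (\<pi> v x)\<bar> < \<delta>"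
    if "x \<in> C b" "i \<in> I b" "v \<in> V" "\<psi> b i x \<noteq> 0" for b i x v l
    using Q[of b] that unfolding Q_def by blast

  \<comment> \<open>Generic constants on the leaves of a star forest\<close>
  obtain L c where L: "L \<subseteq> V" "\<And>v. v \<in> L \<Longrightarrow> c v \<in> V - L \<and> E v (c v)" "card V \<le> 2 * card L"
    using spanning_star_forest[OF \<open>finite V\<close> nbr sym] by metis
  have "finite L" using L(1) \<open>finite V\<close> by (rule finite_subset)
  define co where "co v l i = (1 - \<delta>) * f l (\<pi> v (\<xi> (pos v) i))" for v l i
  \<comment> \<open>For \<open>k = (v, l)\<close> this is the coefficient of the \<open>i\<close>-th
    barycentric coordinate of block \<open>b\<close> in the difference of the approximations at the
    centre \<open>c v\<close> and at the leaf \<open>v\<close>. Both vertices may use the same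
    block, hence the two separate tests.\<close>
  define A where "A b i k = (case k of (v, l) \<Rightarrow>
      (if pos (c v) = b then co (c v) l i else 0) - (if pos v = b then co v l i else 0))" for b i k
  \<comment> \<open>The forest has at least \<open>card V / 2\<close> leaves, so the constants are
    numerous enough for the dimension bound divided by two.\<close>
  have size': "n True + n False < int (card (L \<times> (UNIV :: 'r set)))"
  proof -
    define p q where "p = CARD('r) * card V" and "q = card (L \<times> (UNIV :: 'r set))"
    have "p \<le> 2 * q"
      using mult_le_mono2[OF L(3), of "CARD('r)"] unfolding p_def q_def
      by (simp add: card_cartesian_product mult.assoc mult.left_commute mult.commute)
    with size show ?thesis unfolding p_def[symmetric] q_def[symmetric] by presburger
  qed
  obtain t where t: "\<forall>k\<in>L \<times> (UNIV :: 'r set). 0 < t k \<and> t k < \<delta>"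
    and tno: "\<forall>\<psi>. (\<forall>b. (\<Sum>i\<in>I b. \<psi> b i) = 1 \<and> int (card {i\<in>I b. \<psi> b i \<noteq> 0}) \<le> n b + 1) \<longrightarrow>
      (\<exists>k\<in>L \<times> (UNIV :: 'r set).
        (\<Sum>i\<in>I True. \<psi> True i * A True i k) + (\<Sum>i\<in>I False. \<psi> False i * A False i k) \<noteq> t k)"
    by (rule avoid_simplex_differences[where I = I and A = A,
          OF finite_cartesian_product[OF \<open>finite L\<close> finite] finI size' \<delta>(1)]) (rule that)
  define f0 where "f0 v l x = (\<Sum>i\<in>I (pos v). \<psi> (pos v) i x * co v l i)" for v l x
  define f1 where "f1 v l x = f0 v l x + (if v \<in> L then t (v, l) else 0)" for v l x
  have co01: "0 \<le> co v l i \<and> co v l i \<le> 1 - \<delta>" if "v \<in> V" "i \<in> I (pos v)" for v l i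
  proof -
    have "\<pi> v (\<xi> (pos v) i) \<in> topspace T"
      using \<xi>C[OF that(2)] CT \<pi>[OF that(1)] by (metis continuous_map_image_subset_topspace image_subset_iff)
    from f01[OF this, of l] show ?thesis using \<delta> unfolding co_def by (simp add: mult_left_le)
  qed
  have f0_bound: "0 \<le> f0 v l x \<and> f0 v l x \<le> 1 - \<delta>" if v: "v \<in> V" and x: "x \<in> C (pos v)" for v l x
  proof
    show "0 \<le> f0 v l x"
      unfolding f0_def using v x \<psi>0 co01 by (intro sum_nonneg mult_nonneg_nonneg) auto
    have "f0 v l x \<le> (\<Sum>i\<in>I (pos v). \<psi> (pos v) i x * (1 - \<delta>))"
      unfolding f0_def using v x \<psi>0 co01 by (intro sum_mono mult_left_mono) auto
    also have "\<dots> = 1 - \<delta>" using \<psi>1[OF x] by (simp add: sum_distrib_right[symmetric])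
    finally show "f0 v l x \<le> 1 - \<delta>" .
  qed
  \<comment> \<open>One \<open>\<delta>\<close> comes from the scaling by
    \<open>1 - \<delta>\<close>, the other from replacing \<open>x\<close> by a vertex of its
    simplex. The constants on the leaves later add a third.\<close>
  have f0_near: "\<bar>f0 v l x - f l (\<pi> v x)\<bar> \<le> 2 * \<delta>" if v: "v \<in> V" and x: "x \<in> C (pos v)" for v l x
  proof -
    have px: "\<pi> v x \<in> topspace T"
      using CT[OF x] \<pi>[OF v] by (metis continuous_map_image_subset_topspace image_subset_iff)
    have step: "\<bar>co v l i - f l (\<pi> v x)\<bar> \<le> 2 * \<delta>" if "i \<in> I (pos v)" "\<psi> (pos v) i x \<noteq> 0" for i
    proof -
      let ?y = "f l (\<pi> v (\<xi> (pos v) i))"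
      have "\<pi> v (\<xi> (pos v) i) \<in> topspace T"
        using \<xi>C[OF that(1)] CT \<pi>[OF v] by (metis continuous_map_image_subset_topspace image_subset_iff)
      then have "0 \<le> ?y" "?y \<le> 1" using f01 by auto
      then have "0 \<le> \<delta> * ?y" "\<delta> * ?y \<le> \<delta>" using \<delta> by (auto simp: mult_left_le)
      moreover have "\<bar>?y - f l (\<pi> v x)\<bar> < \<delta>" using \<psi>near[OF x that(1) v that(2)] .
      ultimately show ?thesis unfolding co_def left_diff_distrib mult_1 by linarith
    qed
    have "f0 v l x - f l (\<pi> v x) = (\<Sum>i\<in>I (pos v). \<psi> (pos v) i x * (co v l i - f l (\<pi> v x)))"
      unfolding f0_def using \<psi>1[OF x] by (simp add: right_diff_distrib sum_subtractf sum_distrib_right[symmetric])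
    also have "\<bar>\<dots>\<bar> \<le> (\<Sum>i\<in>I (pos v). \<bar>\<psi> (pos v) i x * (co v l i - f l (\<pi> v x))\<bar>)"
      by (rule sum_abs)
    also have "\<dots> \<le> (\<Sum>i\<in>I (pos v). \<psi> (pos v) i x * (2 * \<delta>))"
    proof (rule sum_mono)
      fix i assume i: "i \<in> I (pos v)"
      show "\<bar>\<psi> (pos v) i x * (co v l i - f l (\<pi> v x))\<bar> \<le> \<psi> (pos v) i x * (2 * \<delta>)"
        using step[OF i] \<psi>0[OF i x] by (cases "\<psi> (pos v) i x = 0") (auto simp: abs_mult intro!: mult_left_mono)
    qed
    also have "\<dots> = 2 * \<delta>" using \<psi>1[OF x] by (simp add: sum_distrib_right[symmetric])
    finally show ?thesis .
  qed
  have t': "0 \<le> (if v \<in> L then t (v, l) else 0)" "(if v \<in> L then t (v, l) else 0) \<le> \<delta>" for v l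
    using t \<delta> by (auto simp: less_imp_le)
  have f1_bound: "0 \<le> f1 v l x \<and> f1 v l x \<le> 1" if "v \<in> V" "x \<in> C (pos v)" for v l x
    using f0_bound[OF that, of l] t'[of v l] unfolding f1_def by linarith
  have f1_near: "\<bar>f1 v l x - f l (\<pi> v x)\<bar> \<le> 3 * \<delta>" if "v \<in> V" "x \<in> C (pos v)" for v l x
    using f0_near[OF that, of l] t'[of v l] unfolding f1_def by linarith
  have f1_cont: "continuous_map (subtopology T (C (pos v))) euclideanreal (f1 v l)" for v l
    unfolding f1_def f0_def using finI \<psi>cont
    by (intro continuous_map_add continuous_map_sum continuous_map_real_mult) auto

  \<comment> \<open>Extension of the new values to the whole space\<close>
  have hausd: "Hausdorff_space T" using met by (rule metrizable_imp_Hausdorff_space)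
  define D where "D v = \<pi> v ` C (pos v)" for v
  have Dclosed: "closedin T (D v)" if "v \<in> V" for v
    unfolding D_def using continuous_imp_closed_map[OF \<pi>[OF that] comp hausd] C
    unfolding closed_map_def by blast
  define Z where "Z = (\<Union>v\<in>V. D v)"
  have Zclosed: "closedin T Z"
    unfolding Z_def using \<open>finite V\<close> Dclosed by (intro closedin_Union) auto
  \<comment> \<open>The corrections \<open>f1 - f\<close> are pasted over the disjoint closed
    translates and extended by Tietze. Extending the correction, and not the new function, keeps the
    result uniformly close to \<open>f\<close>.\<close>
  have "\<exists>h. continuous_map T euclideanreal h \<and> (\<forall>x\<in>topspace T. \<bar>h x\<bar> \<le> 3 * \<delta>) \<and>
      (\<forall>v\<in>V. \<forall>x\<in>C (pos v). h (\<pi> v x) = f1 v l x - f l (\<pi> v x))" for l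
  proof -
    have cl: "closedin (subtopology T Z) (D v)" if "v \<in> V" for v
      using that Dclosed unfolding Z_def by (intro closedin_subset_topspace) auto
    have co: "continuous_map (subtopology (subtopology T Z) (D v)) euclideanreal (\<lambda>z. f1 v l (\<rho> v z) - f l z)"
      if "v \<in> V" for v
    proof -
      have sub: "subtopology (subtopology T Z) (D v) = subtopology T (D v)"
        using that unfolding Z_def by (metis Int_absorb1 UN_upper subtopology_subtopology)
      have "continuous_map (subtopology T (D v)) (subtopology T (C (pos v))) (\<rho> v)"
        using \<rho>[OF that] inv[OF that] CT unfolding continuous_map_in_subtopology D_def
        by (auto intro: continuous_map_from_subtopology)
      from continuous_map_compose[OF this f1_cont]
      have "continuous_map (subtopology T (D v)) euclideanreal (\<lambda>z. f1 v l (\<rho> v z))"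
        by (simp add: o_def)
      then show ?thesis
        unfolding sub by (rule continuous_map_diff) (rule continuous_map_from_subtopology[OF f])
    qed
    have ag: "f1 v l (\<rho> v z) - f l z = f1 w l (\<rho> w z) - f l z"
      if "v \<in> V" "w \<in> V" "z \<in> topspace (subtopology T Z) \<inter> D v \<inter> D w" for v w z
      using disj[of v w] that unfolding D_def by fastforce
    have top': "topspace (subtopology T Z) \<subseteq> \<Union> (D ` V)" unfolding Z_def by auto
    obtain g where g: "continuous_map (subtopology T Z) euclideanreal g"
      "\<And>z v. v \<in> V \<Longrightarrow> z \<in> topspace (subtopology T Z) \<inter> D v \<Longrightarrow> g z = f1 v l (\<rho> v z) - f l z"
      using pasting_lemma_exists_closed[where f="\<lambda>v z. f1 v l (\<rho> v z) - f l z", OF \<open>finite V\<close> top' cl co ag] by blast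
    have g_eq: "g (\<pi> v x) = f1 v l x - f l (\<pi> v x)" if "v \<in> V" "x \<in> C (pos v)" for v x
    proof -
      have "\<pi> v x \<in> D v" unfolding D_def using that by blast
      moreover have "D v \<subseteq> topspace T" using Dclosed[OF that(1)] by (rule closedin_subset)
      ultimately have "g (\<pi> v x) = f1 v l (\<rho> v (\<pi> v x)) - f l (\<pi> v x)"
        using that(1) unfolding Z_def by (intro g(2)) (auto simp: Z_def)
      then show ?thesis using inv[OF that(1) CT[OF that(2)]] by simp
    qed
    have "g ` Z \<subseteq> {- 3 * \<delta>..3 * \<delta>}"
    proof
      fix y assume "y \<in> g ` Z"
      then obtain v x where "v \<in> V" "x \<in> C (pos v)" "y = g (\<pi> v x)" unfolding Z_def D_def by blast
      then show "y \<in> {- 3 * \<delta>..3 * \<delta>}" using f1_near[of v x l] by (auto simp: g_eq abs_le_iff)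
    qed
    moreover have "is_interval {- 3 * \<delta>..3 * \<delta>}" "{- 3 * \<delta>..3 * \<delta>} \<noteq> {}"
      using \<delta> by (auto simp: is_interval_cc)
    ultimately obtain h where h: "continuous_map T euclideanreal h" "h ` topspace T \<subseteq> {- 3 * \<delta>..3 * \<delta>}"
      "\<And>z. z \<in> Z \<Longrightarrow> h z = g z"
      using Tietze_extension_realinterval[OF metrizable_imp_normal_space[OF met] Zclosed _ _ g(1)] by metis
    have "h (\<pi> v x) = f1 v l x - f l (\<pi> v x)" if "v \<in> V" "x \<in> C (pos v)" for v x
      using g_eq[OF that] h(3)[of "\<pi> v x"] that unfolding Z_def D_def by auto
    moreover have "\<bar>h x\<bar> \<le> 3 * \<delta>" if "x \<in> topspace T" for x
      using h(2) that by (auto simp: abs_le_iff image_subset_iff)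
    ultimately show ?thesis using h(1) by blast
  qed
  then obtain h where h: "\<And>l. continuous_map T euclideanreal (h l)"
    "\<And>l x. x \<in> topspace T \<Longrightarrow> \<bar>h l x\<bar> \<le> 3 * \<delta>"
    "\<And>l v x. v \<in> V \<Longrightarrow> x \<in> C (pos v) \<Longrightarrow> h l (\<pi> v x) = f1 v l x - f l (\<pi> v x)" by metis
  \<comment> \<open>Clipping does not increase the distance to \<open>f\<close>, which lies in the
    unit interval, and leaves the translates alone, where \<open>f + h\<close> equals
    \<open>f1\<close> and is already in range.\<close>
  define f' where "f' l x = max 0 (min 1 (f l x + h l x))" for l x
  have f'_eq: "f' l (\<pi> v x) = f1 v l x" if "v \<in> V" "x \<in> C (pos v)" for l v x
    unfolding f'_def using h(3)[OF that, of l] f1_bound[OF that, of l] by simp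
  show thesis
  proof
    show "continuous_map T euclideanreal (f' l)" for l
      unfolding f'_def using f h(1)
      by (intro continuous_map_real_max continuous_map_real_min continuous_map_add) auto
    show "0 \<le> f' l x \<and> f' l x \<le> 1" for l x unfolding f'_def by auto
    show "\<bar>f' l x - f l x\<bar> < \<epsilon>" if "x \<in> topspace T" for l x
      using h(2)[OF that, of l] f01[OF that, of l] \<delta>(3) unfolding f'_def by auto
    fix x assume "\<forall>b. x b \<in> C b"
    then have x: "x b \<in> C b" for b by blast
    obtain v l where "v \<in> L" and ne: "(\<Sum>i\<in>I True. \<psi> True i (x True) * A True i (v, l))
        + (\<Sum>i\<in>I False. \<psi> False i (x False) * A False i (v, l)) \<noteq> t (v, l)"
      using tno[rule_format, of "\<lambda>b i. \<psi> b i (x b)"] \<psi>1[OF x] \<psi>card[OF x] by auto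
    have cv: "c v \<in> V" "c v \<notin> L" "E v (c v)" "v \<in> V" using L \<open>v \<in> L\<close> by auto
    have "(\<Sum>i\<in>I True. \<psi> True i (x True) * A True i (v, l))
        + (\<Sum>i\<in>I False. \<psi> False i (x False) * A False i (v, l))
        = f0 (c v) l (x (pos (c v))) - f0 v l (x (pos v))"
      unfolding f0_def A_def
      by (cases "pos v"; cases "pos (c v)") (simp_all add: right_diff_distrib sum_subtractf sum_negf)
    \<comment> \<open>The leaf \<open>v\<close> carries the constant \<open>t (v, l)\<close> and its
      centre carries none, so equal values of \<open>f1\<close> would make the difference of the
      approximations equal to \<open>t (v, l)\<close>.\<close>
    with ne have "f1 v l (x (pos v)) \<noteq> f1 (c v) l (x (pos (c v)))"
      unfolding f1_def using \<open>v \<in> L\<close> cv by auto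
    then show "\<exists>v\<in>V. \<exists>w\<in>V. E v w \<and> (\<exists>l. f' l (\<pi> v (x (pos v))) \<noteq> f' l (\<pi> w (x (pos w))))"
      using cv x f'_eq by metis
  qed
qed

section \<open>Topology of the action and growth of orbits\<close>

text \<open>Total boundedness gives a finite net for every radius \<open>1 / Suc n\<close>; the
  balls around all nets form the family. Closed balls are taken because dimension bounds pass to
  closed subsets and because products of closed sets are compact here.\<close>

lemma compact_metrizable_countable_closed_base:
  assumes "metrizable_space T" "compact_space T"
  obtains \<Q> where "countable \<Q>" "\<And>Q. Q \<in> \<Q> \<Longrightarrow> closedin T Q"
    "\<And>U x. openin T U \<Longrightarrow> x \<in> U \<Longrightarrow> \<exists>Q\<in>\<Q>. x \<in> Q \<and> Q \<subseteq> U"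
proof -
  obtain M d where "Metric_space M d" and T: "T = Metric_space.mtopology M d"
    using assms(1) unfolding metrizable_space_def by blast
  then interpret Metric_space M d by simp
  have "mtotally_bounded M"
    using assms(2) unfolding T compact_space_def topspace_mtopology by (rule compactin_imp_mtotally_bounded)
  then have "\<forall>n::nat. \<exists>K. finite K \<and> K \<subseteq> M \<and> M \<subseteq> (\<Union>x\<in>K. mball x (1 / Suc n))"
    unfolding mtotally_bounded_def by simp
  then obtain K where K: "\<And>n. finite (K n)" "\<And>n. M \<subseteq> (\<Union>x\<in>K n. mball x (1 / real (Suc n)))"
    by metis
  define \<Q> where "\<Q> = (\<Union>n. (\<lambda>q. mcball q (1 / real (Suc n))) ` K n)"
  show thesis
  proof
    show "countable \<Q>" unfolding \<Q>_def using K(1) by (auto intro: countable_finite)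
    show "closedin T Q" if "Q \<in> \<Q>" for Q using that unfolding \<Q>_def T by auto
    show "\<exists>Q\<in>\<Q>. x \<in> Q \<and> Q \<subseteq> U" if "openin T U" "x \<in> U" for U x
    proof -
      obtain r where r: "r > 0" "mball x r \<subseteq> U" "x \<in> M"
        using \<open>openin T U\<close> \<open>x \<in> U\<close> unfolding T openin_mtopology by blast
      obtain n where n: "1 / real (Suc n) < r / 2"
        using r(1) nat_approx_posE[of "r/2"] by auto
      obtain q where q: "q \<in> K n" "x \<in> mball q (1 / real (Suc n))" using K(2)[of n] r(3) by blast
      have "mcball q (1 / real (Suc n)) \<subseteq> mball x r"
      proof
        fix z assume z: "z \<in> mcball q (1 / real (Suc n))"
        then have "d x z \<le> d q x + d q z" using q(2) triangle[of x q z] by (simp add: commute)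
        also have "\<dots> < r" using q(2) z n by auto
        finally show "z \<in> mball x r" using z r(3) by simp
      qed
      moreover have "mcball q (1 / real (Suc n)) \<in> \<Q>" unfolding \<Q>_def using q(1) by blast
      moreover have "x \<in> mcball q (1 / real (Suc n))" using q(2) by auto
      ultimately show ?thesis using r(2) by blast
    qed
  qed
qed

lemma Hausdorff_finite_separation:
  assumes "Hausdorff_space T" "finite V" "V \<subseteq> topspace T"
  obtains U where "\<And>v. v \<in> V \<Longrightarrow> openin T (U v) \<and> v \<in> U v"
    "\<And>v w. v \<in> V \<Longrightarrow> w \<in> V \<Longrightarrow> v \<noteq> w \<Longrightarrow> U v \<inter> U w = {}"
proof -
  have "\<forall>v w. v \<in> V \<and> w \<in> V \<and> v \<noteq> w \<longrightarrow> (\<exists>A B. openin T A \<and> openin T B \<and> v \<in> A \<and> w \<in> B \<and> A \<inter> B = {})"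
    using assms(1,3) unfolding Hausdorff_space_def disjnt_def by blast
  then obtain A B where AB: "\<And>v w. v \<in> V \<Longrightarrow> w \<in> V \<Longrightarrow> v \<noteq> w \<Longrightarrow>
      openin T (A v w) \<and> openin T (B v w) \<and> v \<in> A v w \<and> w \<in> B v w \<and> A v w \<inter> B v w = {}"
    by metis
  \<comment> \<open>The separating sets depend on the ordered pair, so \<open>U v\<close> uses the
    side of \<open>v\<close> in both \<open>(v, w)\<close> and \<open>(w, v)\<close>. The whole
    space covers the case of a single point.\<close>
  define U where "U v = (\<Inter>w\<in>V - {v}. A v w \<inter> B w v) \<inter> topspace T" for v
  show thesis
  proof
    show "openin T (U v) \<and> v \<in> U v" if "v \<in> V" for v
    proof
      show "openin T (U v)"
        unfolding U_def using that AB \<open>finite V\<close> by (intro openin_INT openin_Int) auto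
      show "v \<in> U v" unfolding U_def using that AB assms(3) by auto
    qed
    show "U v \<inter> U w = {}" if "v \<in> V" "w \<in> V" "v \<noteq> w" for v w
    proof -
      have "U v \<subseteq> A v w" "U w \<subseteq> B v w" unfolding U_def using that by auto
      then show ?thesis using AB[OF that] by blast
    qed
  qed
qed

section \<open>Words in the generators\<close>

lemma finite_products_of_length: "finite S \<Longrightarrow> finite (products_of_length G S n)"
proof -
  assume "finite S"
  then have "finite (foldr (mult G) ` {ss. set ss \<subseteq> S \<and> length ss = n})"
    by (intro finite_imageI finite_lists_length_eq)
  moreover have "products_of_length G S n = (\<lambda>h. h \<one>\<^bsub>G\<^esub>) ` foldr (mult G) ` {ss. set ss \<subseteq> S \<and> length ss = n}"
    unfolding products_of_length_def by auto
  ultimately show ?thesis by simp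
qed

lemma finite_products_up_to_length: "finite S \<Longrightarrow> finite (products_up_to_length G S n)"
  unfolding products_up_to_length_def by (simp add: finite_products_of_length)

lemma (in monoid) foldr_mult_closed: "set ss \<subseteq> carrier G \<Longrightarrow> foldr (mult G) ss \<one> \<in> carrier G"
  by (induction ss) auto

lemma (in monoid) products_up_to_length_closed:
  assumes "S \<subseteq> carrier G"
  shows "products_up_to_length G S n \<subseteq> carrier G"
proof
  fix g assume "g \<in> products_up_to_length G S n"
  then obtain ss where "g = foldr (mult G) ss \<one>" "set ss \<subseteq> S"
    unfolding products_up_to_length_def products_of_length_def by auto
  with assms foldr_mult_closed[of ss] show "g \<in> carrier G" by auto
qed

lemma one_products_up_to_length: "\<one>\<^bsub>G\<^esub> \<in> products_up_to_length G S n"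
  unfolding products_up_to_length_def products_of_length_def by force

lemma products_up_to_length_mono: "m \<le> n \<Longrightarrow> products_up_to_length G S m \<subseteq> products_up_to_length G S n"
  unfolding products_up_to_length_def by (intro UN_mono) auto

lemma products_up_to_length_Suc:
  assumes "s \<in> S" "g \<in> products_up_to_length G S n"
  shows "s \<otimes>\<^bsub>G\<^esub> g \<in> products_up_to_length G S (Suc n)"
proof -
  obtain ss where "g = foldr (mult G) ss \<one>\<^bsub>G\<^esub>" "set ss \<subseteq> S" "length ss \<le> n"
    using assms(2) unfolding products_up_to_length_def products_of_length_def by auto
  then have "s \<otimes>\<^bsub>G\<^esub> g \<in> products_of_length G S (Suc (length ss))" "Suc (length ss) \<in> {0..Suc n}"
    unfolding products_of_length_def using assms(1) by (auto intro!: exI[of _ "s # ss"])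
  then show ?thesis unfolding products_up_to_length_def by blast
qed

section \<open>Closed sets defined by the action, and orbits\<close>

context topological_dynamical_system
begin

abbreviation "T \<equiv> mtopology_of X"

lemma group_G: "group G"
  using group_hom unfolding group_hom_def by simp

lemma metrizable: "metrizable_space T"
  unfolding metrizable_space_def mtopology_of_def using Metric_space_mspace_mdist by blast

lemma action_closed: "g \<in> carrier G \<Longrightarrow> x \<in> mspace X \<Longrightarrow> \<phi> g x \<in> mspace X"
  using element_image by blast

lemma continuous_map_action:
  assumes "g \<in> carrier G"
  shows "continuous_map T T (\<phi> g)"
proof -
  have "continuous_map T (prod_topology (discrete_topology (carrier G)) T) (\<lambda>x. (g, x))"
    using assms by (intro continuous_map_pairedI) auto
  from continuous_map_compose[OF this continuous_action] show ?thesis by (simp add: o_def)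
qed

lemma action_one: "x \<in> mspace X \<Longrightarrow> \<phi> \<one> x = x"
  using id_eq_one by (metis restrict_apply')

lemma action_inv: "g \<in> carrier G \<Longrightarrow> x \<in> mspace X \<Longrightarrow> \<phi> (inv g) (\<phi> g x) = x"
  using orbit_sym_aux by blast

lemma closedin_coincidence:
  assumes "g \<in> carrier G" "h \<in> carrier G"
  shows "closedin T {x \<in> mspace X. \<phi> g x = \<phi> h x}"
  using closedin_continuous_maps_eq[OF metrizable_imp_Hausdorff_space[OF metrizable]
      continuous_map_action[OF assms(1)] continuous_map_action[OF assms(2)]] by simp

text \<open>An orbit has at most \<open>N\<close> points iff among any \<open>N + 1\<close> group
  elements two agree on \<open>x\<close>. This presents the set as an intersection of finite unions
  of coincidence sets.\<close>

lemma closedin_small_orbit_points: "closedin T (small_orbit_points G X \<phi> N)"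
proof -
  define \<H> where "\<H> = {H. H \<subseteq> carrier G \<and> finite H \<and> card H = Suc N}"
  define P where "P H = (\<Union>(g, h)\<in>{(g, h). g \<in> H \<and> h \<in> H \<and> g \<noteq> h}. {x \<in> mspace X. \<phi> g x = \<phi> h x})" for H
  have "closedin T (P H)" if "H \<in> \<H>" for H
  proof -
    have "finite {(g, h). g \<in> H \<and> h \<in> H \<and> g \<noteq> h}"
      using that unfolding \<H>_def by (auto intro: finite_subset[of _ "H \<times> H"])
    then show ?thesis
      unfolding P_def using that closedin_coincidence unfolding \<H>_def
      by (intro closedin_Union) auto
  qed
  \<comment> \<open>If \<open>G\<close> has at most \<open>N\<close> elements, \<open>\<H>\<close>
    is empty and the intersection is all of \<open>mspace X\<close>.\<close>
  then have "closedin T (mspace X \<inter> (\<Inter>H\<in>\<H>. P H))"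
    by (cases "\<H> = {}") (auto intro!: closedin_Int closedin_Inter simp flip: topspace_mtopology_of)
  also have "mspace X \<inter> (\<Inter>H\<in>\<H>. P H) = small_orbit_points G X \<phi> N"
  proof (intro Set.set_eqI iffI)
    fix x assume x: "x \<in> mspace X \<inter> (\<Inter>H\<in>\<H>. P H)"
    have False if big: "infinite (orbit G \<phi> x) \<or> Suc N \<le> card (orbit G \<phi> x)"
    proof -
      obtain B where B: "B \<subseteq> orbit G \<phi> x" "finite B" "card B = Suc N"
        using big by (metis infinite_arbitrarily_large obtain_subset_with_card_n)
      have "\<forall>y\<in>B. \<exists>g. g \<in> carrier G \<and> \<phi> g x = y" using B(1) unfolding orbit_def by auto
      then obtain k where k: "\<And>y. y \<in> B \<Longrightarrow> k y \<in> carrier G \<and> \<phi> (k y) x = y" by metis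
      then have "inj_on k B" by (metis inj_onI)
      then have "k ` B \<in> \<H>" unfolding \<H>_def using B k by (auto simp: card_image)
      then have "x \<in> P (k ` B)" using x by blast
      then show False unfolding P_def using k by auto
    qed
    then show "x \<in> small_orbit_points G X \<phi> N"
      unfolding small_orbit_points_def using x by fastforce
  next
    fix x assume x: "x \<in> small_orbit_points G X \<phi> N"
    have "x \<in> P H" if H: "H \<in> \<H>" for H
    proof -
      have "(\<lambda>g. \<phi> g x) ` H \<subseteq> orbit G \<phi> x" using H unfolding \<H>_def orbit_def by auto
      moreover have "finite (orbit G \<phi> x)" "card (orbit G \<phi> x) \<le> N"
        using x unfolding small_orbit_points_def by auto
      ultimately have "card ((\<lambda>g. \<phi> g x) ` H) \<le> N" using card_mono le_trans by blast
      moreover have "card H = Suc N" using H unfolding \<H>_def by simp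
      ultimately have "card ((\<lambda>g. \<phi> g x) ` H) < card H" by simp
      then have "\<not> inj_on (\<lambda>g. \<phi> g x) H" by (metis card_image less_irrefl)
      then show ?thesis using x unfolding P_def inj_on_def small_orbit_points_def by fastforce
    qed
    then show "x \<in> mspace X \<inter> (\<Inter>H\<in>\<H>. P H)" using x unfolding small_orbit_points_def by auto
  qed
  finally show ?thesis .
qed

text \<open>
  If \<open>F\<^sub>n x\<close> stops growing, then it is a finite set mapped injectively into itself by every \<open>s \<in> S\<close>,
  hence also by \<open>s\<inverse>\<close>, although \<open>S\<close> need not contain inverses.
\<close>

lemma orbit_growth:
  assumes "finite S" and S: "S \<subseteq> carrier G" "generate G S = carrier G" and x: "x \<in> mspace X"
  shows "n < card ((\<lambda>g. \<phi> g x) ` products_up_to_length G S n)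
    \<or> (\<lambda>g. \<phi> g x) ` products_up_to_length G S n = orbit G \<phi> x"
proof (induction n)
  interpret group G by (rule group_G)
  let ?B = "\<lambda>n. (\<lambda>g. \<phi> g x) ` products_up_to_length G S n"
  have fin: "finite (?B n)" for n by (intro finite_imageI finite_products_up_to_length \<open>finite S\<close>)
  have mono: "?B n \<subseteq> ?B (Suc n)" for n
    using products_up_to_length_mono[of n "Suc n" G S] by auto
  have sub: "?B n \<subseteq> orbit G \<phi> x" for n
    using products_up_to_length_closed[OF S(1)] unfolding orbit_def by auto
  case 0
  have "?B 0 \<noteq> {}" using one_products_up_to_length[of G S 0] by blast
  with fin[of 0] show ?case by (simp add: card_gt_0_iff)
  case (Suc n)
  show ?case
  proof (cases "?B n = ?B (Suc n)")
    case False
    with mono[of n] have "?B n \<subset> ?B (Suc n)" by blast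
    then have "card (?B n) < card (?B (Suc n))" using fin by (rule psubset_card_mono[rotated])
    moreover have "?B n = orbit G \<phi> x \<Longrightarrow> ?B (Suc n) = orbit G \<phi> x" using mono[of n] sub[of "Suc n"] by blast
    ultimately show ?thesis using Suc by linarith
  next
    case True
    have BX: "?B n \<subseteq> mspace X"
      using products_up_to_length_closed[OF S(1)] action_closed x by auto
    have stable: "\<phi> s ` ?B n \<subseteq> ?B n" if s: "s \<in> S" for s
    proof
      fix y assume "y \<in> \<phi> s ` ?B n"
      then obtain g where g: "g \<in> products_up_to_length G S n" "y = \<phi> s (\<phi> g x)" by blast
      then have "y = \<phi> (s \<otimes> g) x"
        using composition_rule[OF x subsetD[OF S(1) s] subsetD[OF products_up_to_length_closed[OF S(1)] g(1)]]
        by simp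
      then have "y \<in> ?B (Suc n)" using products_up_to_length_Suc[OF s g(1)] by blast
      then show "y \<in> ?B n" unfolding True .
    qed
    have onto: "\<phi> s ` ?B n = ?B n" if s: "s \<in> S" for s
    proof -
      have "inj_on (\<phi> s) (?B n)" using inj_prop[of s] s S(1) BX by (meson inj_on_subset subsetD)
      then show ?thesis using endo_inj_surj[OF fin stable[OF s]] by blast
    qed
    \<comment> \<open>Once every element of \<open>G\<close> preserves \<open>?B n\<close>, which
      contains \<open>x\<close>, the whole orbit lies inside it.\<close>
    have "\<phi> g ` ?B n \<subseteq> ?B n" if "g \<in> generate G S" for g
      using that
    proof (induction rule: generate.induct)
      case one
      then show ?case using BX action_one by auto
    next
      case (incl h)
      then show ?case by (rule stable)
    next
      case (inv h)
      show ?case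
      proof
        fix y assume "y \<in> \<phi> (inv h) ` ?B n"
        then obtain z where z: "z \<in> ?B n" "y = \<phi> (inv h) z" by blast
        then obtain w where w: "w \<in> ?B n" "z = \<phi> h w" using onto[OF inv] by blast
        then have "y = w" using z action_inv[of h w] inv S(1) BX by blast
        then show "y \<in> ?B n" using w by simp
      qed
    next
      case (eng h1 h2)
      have h: "h1 \<in> carrier G" "h2 \<in> carrier G" using eng.hyps S(2) by simp_all
      show ?case
      proof
        fix y assume "y \<in> \<phi> (h1 \<otimes> h2) ` ?B n"
        then obtain z where z: "z \<in> ?B n" "y = \<phi> (h1 \<otimes> h2) z" by blast
        then have "y = \<phi> h1 (\<phi> h2 z)" using composition_rule h BX by blast
        then show "y \<in> ?B n" using z eng.IH by blast
      qed
    qed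
    moreover have "x \<in> ?B n" using one_products_up_to_length[of G S n] action_one[OF x] by (metis image_eqI)
    ultimately have "orbit G \<phi> x \<subseteq> ?B n" unfolding orbit_def S(2) by blast
    then show ?thesis using sub[of n] True by auto
  qed
qed

end

section \<open>A countable cover by perturbable sets\<close>

text \<open>Density of the functions that separate all pairs of \<open>Z\<close> along
  \<open>F\<close>, phrased by coordinate functions to keep the function space and the cube out of
  the construction. The argument \<open>r\<close> fixes the index type of the coordinates, which
  otherwise occurs only in bound variables.\<close>

definition perturbable ::
    "'r::finite itself \<Rightarrow> 'x topology \<Rightarrow> ('g \<Rightarrow> 'x \<Rightarrow> 'x) \<Rightarrow> 'g set \<Rightarrow> ('x \<times> 'x) set \<Rightarrow> bool" where
  "perturbable r T \<phi> F Z \<longleftrightarrow>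
    (\<forall>(f :: 'r \<Rightarrow> 'x \<Rightarrow> real) \<epsilon>. \<epsilon> > 0 \<longrightarrow> (\<forall>l. continuous_map T euclideanreal (f l)) \<longrightarrow>
        (\<forall>l. \<forall>x\<in>topspace T. 0 \<le> f l x \<and> f l x \<le> 1) \<longrightarrow>
      (\<exists>f' :: 'r \<Rightarrow> 'x \<Rightarrow> real. (\<forall>l. continuous_map T euclideanreal (f' l)) \<and>
        (\<forall>l. \<forall>x\<in>topspace T. 0 \<le> f' l x \<and> f' l x \<le> 1) \<and>
        (\<forall>l. \<forall>x\<in>topspace T. \<bar>f' l x - f l x\<bar> < \<epsilon>) \<and>
        (\<forall>(x, y)\<in>Z. \<exists>g\<in>F. \<exists>l. f' l (\<phi> g x) \<noteq> f' l (\<phi> g y))))"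

context topological_dynamical_system
begin

text \<open>A vertex \<open>v\<close> stands for the block \<open>\<phi> (k v)\<close> followed by
  the chart \<open>C (pos v)\<close>. By \<open>track\<close>, the points \<open>g x\<close> and
  \<open>g y\<close> of a pair in \<open>Z\<close> lie in the blocks of \<open>g x0\<close> and
  \<open>g y0\<close>, all read off from one choice \<open>p\<close> of chart points. An edge with
  different values at its ends thus yields an element of \<open>F\<close> separating
  \<open>x\<close> and \<open>y\<close>.\<close>

lemma perturbableI:
  fixes C :: "bool \<Rightarrow> 'x set" and n :: "bool \<Rightarrow> int" and pos :: "'x \<Rightarrow> bool" and k :: "'x \<Rightarrow> 'a"
  assumes F: "finite F" "F \<subseteq> carrier G" and xy: "x0 \<in> mspace X" "y0 \<in> mspace X" "x0 \<noteq> y0"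
  defines "V \<equiv> (\<lambda>g. \<phi> g x0) ` F \<union> (\<lambda>g. \<phi> g y0) ` F"
  assumes k: "\<And>v. v \<in> V \<Longrightarrow> k v \<in> carrier G"
    and C: "\<And>b. closedin T (C b)" and dim: "\<And>b. covering_dim_le (subtopology T (C b)) (n b)"
    and disj: "\<And>v w. v \<in> V \<Longrightarrow> w \<in> V \<Longrightarrow> v \<noteq> w \<Longrightarrow> \<phi> (k v) ` C (pos v) \<inter> \<phi> (k w) ` C (pos w) = {}"
    and size: "2 * (n True + n False) < int (CARD('r::finite) * card V)"
    and track: "\<And>x y. (x, y) \<in> Z \<Longrightarrow> \<exists>p. (\<forall>b. p b \<in> C b) \<and>
      (\<forall>g\<in>F. \<phi> (k (\<phi> g x0)) (p (pos (\<phi> g x0))) = \<phi> g x \<and> \<phi> (k (\<phi> g y0)) (p (pos (\<phi> g y0))) = \<phi> g y)"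
  shows "perturbable TYPE('r) T \<phi> F Z"
  unfolding perturbable_def
proof (intro allI impI)
  interpret group G by (rule group_G)
  fix f :: "'r \<Rightarrow> 'x \<Rightarrow> real" and \<epsilon> :: real
  assume f: "\<epsilon> > 0" "\<forall>l. continuous_map T euclideanreal (f l)"
    "\<forall>l. \<forall>x\<in>topspace T. 0 \<le> f l x \<and> f l x \<le> 1"
  define E where "E v w \<longleftrightarrow> (\<exists>g\<in>F. v = \<phi> g x0 \<and> w = \<phi> g y0 \<or> v = \<phi> g y0 \<and> w = \<phi> g x0)" for v w
  have "finite V" unfolding V_def using F by simp
  \<comment> \<open>Each \<open>\<phi> g\<close> is injective, so an edge never joins a vertex to
    itself and no vertex is isolated.\<close>
  have ne: "\<phi> g x0 \<noteq> \<phi> g y0" if "g \<in> F" for g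
    using inj_prop[of g] that F xy unfolding inj_on_def by blast
  have nbr: "\<exists>w\<in>V. w \<noteq> v \<and> E v w" if v: "v \<in> V" for v
  proof -
    obtain g where g: "g \<in> F" "v = \<phi> g x0 \<or> v = \<phi> g y0" using v unfolding V_def by blast
    then show ?thesis using ne[OF g(1)] unfolding V_def E_def by (metis UnCI imageI)
  qed
  have sym: "E w v" if "E v w" for v w using that unfolding E_def by blast
  have \<pi>: "continuous_map T T (\<phi> (k v))" "continuous_map T T (\<phi> (inv (k v)))" if "v \<in> V" for v
    using continuous_map_action k[OF that] by auto
  have inv: "\<phi> (inv (k v)) (\<phi> (k v) x) = x" if "v \<in> V" "x \<in> topspace T" for v x
    using action_inv k[OF that(1)] that(2) by simp
  obtain f' :: "'r \<Rightarrow> 'x \<Rightarrow> real" where f':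
    "\<And>l. continuous_map T euclideanreal (f' l)"
    "\<And>l x. x \<in> topspace T \<Longrightarrow> 0 \<le> f' l x \<and> f' l x \<le> 1"
    "\<And>l x. x \<in> topspace T \<Longrightarrow> \<bar>f' l x - f l x\<bar> < \<epsilon>"
    "\<And>p. \<forall>b. p b \<in> C b \<Longrightarrow>
      \<exists>v\<in>V. \<exists>w\<in>V. E v w \<and> (\<exists>l. f' l (\<phi> (k v) (p (pos v))) \<noteq> f' l (\<phi> (k w) (p (pos w))))"
    by (rule generic_perturbation[where \<pi> = "\<lambda>v. \<phi> (k v)" and \<rho> = "\<lambda>v. \<phi> (inv (k v))",
          OF metrizable compact C dim \<open>finite V\<close> \<pi> inv disj nbr sym size f(2)[rule_format] f(3)[rule_format] f(1)])
       (assumption | rule that)+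
  have "\<exists>g\<in>F. \<exists>l. f' l (\<phi> g x) \<noteq> f' l (\<phi> g y)" if z: "(x, y) \<in> Z" for x y
  proof -
    obtain p where p: "\<And>b. p b \<in> C b" "\<And>g. g \<in> F \<Longrightarrow> \<phi> (k (\<phi> g x0)) (p (pos (\<phi> g x0))) = \<phi> g x"
      "\<And>g. g \<in> F \<Longrightarrow> \<phi> (k (\<phi> g y0)) (p (pos (\<phi> g y0))) = \<phi> g y"
      using track[OF z] by blast
    obtain v w l where "E v w" "f' l (\<phi> (k v) (p (pos v))) \<noteq> f' l (\<phi> (k w) (p (pos w)))"
      using f'(4)[of p] p(1) by blast
    then show ?thesis unfolding E_def using p(2,3) by metis
  qed
  then have "\<forall>(x, y)\<in>Z. \<exists>g\<in>F. \<exists>l. f' l (\<phi> g x) \<noteq> f' l (\<phi> g y)" by blast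
  with f'(1-3) show "\<exists>f' :: 'r \<Rightarrow> 'x \<Rightarrow> real. (\<forall>l. continuous_map T euclideanreal (f' l)) \<and>
        (\<forall>l. \<forall>x\<in>topspace T. 0 \<le> f' l x \<and> f' l x \<le> 1) \<and>
        (\<forall>l. \<forall>x\<in>topspace T. \<bar>f' l x - f l x\<bar> < \<epsilon>) \<and>
        (\<forall>(x, y)\<in>Z. \<exists>g\<in>F. \<exists>l. f' l (\<phi> g x) \<noteq> f' l (\<phi> g y))"
    by (intro exI[of _ f'] conjI allI ballI) auto
qed

definition coincidence_set :: "('a \<times> 'a) set \<Rightarrow> 'x set" where
  "coincidence_set E = {x \<in> mspace X. \<forall>(g, h)\<in>E. \<phi> g x = \<phi> h x}"

text \<open>A basic closed set localises, \<open>A\<close> carries the dimension bound, and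
  \<open>E\<close> prescribes coincidences. Since \<open>K\<close> is finite there are finitely many
  choices of \<open>E\<close>, which keeps the family countable.\<close>

definition charts :: "'x set set \<Rightarrow> 'x set set \<Rightarrow> 'a set \<Rightarrow> 'x set set" where
  "charts \<Q> \<A> K = (\<lambda>(Q, A, E). Q \<inter> A \<inter> coincidence_set E) ` (\<Q> \<times> \<A> \<times> Pow (K \<times> K))"

lemma countable_charts:
  assumes "countable \<Q>" "countable \<A>" "finite K"
  shows "countable (charts \<Q> \<A> K)"
  unfolding charts_def using assms by (intro countable_image countable_SIGMA) (auto intro: countable_finite)

lemma closedin_coincidence_set:
  assumes "E \<subseteq> carrier G \<times> carrier G"
  shows "closedin T (coincidence_set E)"
proof -
  have "coincidence_set E = mspace X \<inter> (\<Inter>(g, h)\<in>E. {x \<in> mspace X. \<phi> g x = \<phi> h x})"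
    unfolding coincidence_set_def by auto
  moreover have "closedin T \<dots>"
  proof (cases "E = {}")
    case True
    then show ?thesis using closedin_topspace[of T] by simp
  next
    case False
    have "closedin T (\<Inter>(g, h)\<in>E. {x \<in> mspace X. \<phi> g x = \<phi> h x})"
      using False assms closedin_coincidence by (intro closedin_INT) auto
    then show ?thesis using closedin_Int[OF closedin_topspace[of T]] by simp
  qed
  ultimately show ?thesis by simp
qed

text \<open>Let \<open>E\<close> record all coincidences of \<open>x0\<close> among elements of
  \<open>K\<close>; the chart is a closed subset of \<open>A\<close> and inherits its dimension
  bound.\<close>

lemma chart_exists:
  assumes K: "K \<subseteq> carrier G"
    and \<Q>: "\<And>Q. Q \<in> \<Q> \<Longrightarrow> closedin T Q"
      "\<And>U x. openin T U \<Longrightarrow> x \<in> U \<Longrightarrow> \<exists>Q\<in>\<Q>. x \<in> Q \<and> Q \<subseteq> U"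
    and A: "A \<in> \<A>" "closedin T A" "x0 \<in> A" "covering_dim_le (subtopology T A) n"
    and N: "openin T N" "x0 \<in> N"
  obtains C where "C \<in> charts \<Q> \<A> K" "x0 \<in> C" "C \<subseteq> N" "closedin T C"
    "covering_dim_le (subtopology T C) n"
    "\<And>x g h. x \<in> C \<Longrightarrow> g \<in> K \<Longrightarrow> h \<in> K \<Longrightarrow> \<phi> g x0 = \<phi> h x0 \<Longrightarrow> \<phi> g x = \<phi> h x"
proof -
  obtain Q where Q: "Q \<in> \<Q>" "x0 \<in> Q" "Q \<subseteq> N" using \<Q>(2)[OF N] by blast
  define E where "E = {(g, h). g \<in> K \<and> h \<in> K \<and> \<phi> g x0 = \<phi> h x0}"
  define C where "C = Q \<inter> A \<inter> coincidence_set E"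
  have E: "E \<subseteq> K \<times> K" unfolding E_def by auto
  have closed: "closedin T C"
    unfolding C_def using \<Q>(1)[OF Q(1)] A(2) closedin_coincidence_set[of E] E K by (intro closedin_Int) auto
  show thesis
  proof
    show "C \<in> charts \<Q> \<A> K"
      unfolding charts_def C_def using Q(1) A(1) E by (auto intro!: image_eqI[of _ _ "(Q, A, E)"])
    show "x0 \<in> C"
      using Q A(3) closedin_subset[OF A(2)] unfolding C_def coincidence_set_def E_def by auto
    show "C \<subseteq> N" using Q(3) unfolding C_def by blast
    show "closedin T C" by (rule closed)
    have "C \<subseteq> A" unfolding C_def by blast
    then have "closedin (subtopology T A) C" using closed by (intro closedin_subset_topspace)
    from covering_dim_le_closed_subset[OF A(4) this] \<open>C \<subseteq> A\<close>
    show "covering_dim_le (subtopology T C) n" by (simp add: subtopology_subtopology Int_absorb1)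
    show "\<phi> g x = \<phi> h x" if "x \<in> C" "g \<in> K" "h \<in> K" "\<phi> g x0 = \<phi> h x0" for x g h
      using that unfolding C_def coincidence_set_def E_def by blast
  qed
qed

lemma openin_finite_preimages:
  assumes "finite W" "\<And>v. v \<in> W \<Longrightarrow> k v \<in> carrier G" "\<And>v. v \<in> W \<Longrightarrow> openin T (U v)"
  shows "openin T {x \<in> mspace X. \<forall>v\<in>W. \<phi> (k v) x \<in> U v}"
proof -
  have "openin T ((\<Inter>v\<in>W. {x \<in> topspace T. \<phi> (k v) x \<in> U v}) \<inter> topspace T)"
    using assms continuous_map_action by (intro openin_INT openin_continuous_map_preimage) auto
  also have "(\<Inter>v\<in>W. {x \<in> topspace T. \<phi> (k v) x \<in> U v}) \<inter> topspace T = {x \<in> mspace X. \<forall>v\<in>W. \<phi> (k v) x \<in> U v}"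
    by auto
  finally show ?thesis .
qed

text \<open>Each pair chooses its own \<open>Z\<close>, but from a countable family: products of
  charts when \<open>F x0\<close> and \<open>F y0\<close> are disjoint, and otherwise graphs of some
  \<open>h \<in> H\<close> over a chart.\<close>

lemma countable_perturbable_cover:
  assumes F: "finite F" "F \<subseteq> carrier G" and "countable \<A>"
    and \<A>: "\<And>x. x \<in> mspace X \<Longrightarrow> \<exists>A\<in>\<A>. \<exists>n. closedin T A \<and> x \<in> A \<and> covering_dim_le (subtopology T A) n \<and>
      2 * n < int (CARD('r::finite) * card ((\<lambda>g. \<phi> g x) ` F))"
  obtains \<Z> where "countable \<Z>"
    "\<And>Z. Z \<in> \<Z> \<Longrightarrow> compactin (prod_topology T T) Z \<and> perturbable TYPE('r) T \<phi> F Z"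
    "\<And>x y. x \<in> mspace X \<Longrightarrow> y \<in> mspace X \<Longrightarrow> x \<noteq> y \<Longrightarrow> \<exists>Z\<in>\<Z>. (x, y) \<in> Z"
proof -
  interpret group G by (rule group_G)
  obtain \<Q> where \<Q>: "countable \<Q>" "\<And>Q. Q \<in> \<Q> \<Longrightarrow> closedin T Q"
    "\<And>U x. openin T U \<Longrightarrow> x \<in> U \<Longrightarrow> \<exists>Q\<in>\<Q>. x \<in> Q \<and> Q \<subseteq> U"
    using compact_metrizable_countable_closed_base[OF metrizable compact] by metis
  \<comment> \<open>If \<open>g1 y0 = g2 x0\<close> then \<open>y0 = h x0\<close> with
    \<open>h = inv g1 \<otimes> g2\<close>, an element of \<open>H\<close>. In that case
    \<open>g y0 = (g \<otimes> h) x0\<close>, so \<open>K\<close> must contain the products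
    \<open>g \<otimes> h\<close> besides \<open>F\<close> for the charts to preserve all relevant
    coincidences.\<close>
  define H where "H = (\<lambda>(g, h). inv g \<otimes> h) ` (F \<times> F)"
  define K where "K = F \<union> (\<lambda>(g, h). g \<otimes> h) ` (F \<times> H)"
  have H: "finite H" "H \<subseteq> carrier G" unfolding H_def using F by auto
  have K: "finite K" "K \<subseteq> carrier G" unfolding K_def using F H by auto
  have FK: "g \<in> K" if "g \<in> F" for g using that unfolding K_def by blast
  define \<C> where "\<C> = charts \<Q> \<A> K"
  define \<Z>0 where "\<Z>0 = (\<lambda>(C, D). C \<times> D) ` (\<C> \<times> \<C>) \<union> (\<lambda>(C, h). (\<lambda>x. (x, \<phi> h x)) ` C) ` (\<C> \<times> H)"
  define \<Z> where "\<Z> = {Z \<in> \<Z>0. compactin (prod_topology T T) Z \<and> perturbable TYPE('r) T \<phi> F Z}"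
  have "countable \<C>" unfolding \<C>_def using \<Q>(1) \<open>countable \<A>\<close> K(1) by (rule countable_charts)
  then have "countable \<Z>0"
    unfolding \<Z>0_def using H(1) by (auto intro: countable_finite)
  then have "countable \<Z>" by (rule countable_subset[rotated]) (auto simp: \<Z>_def)
  moreover have "\<exists>Z\<in>\<Z>. (x0, y0) \<in> Z" if xy: "x0 \<in> mspace X" "y0 \<in> mspace X" "x0 \<noteq> y0" for x0 y0
  proof -
    let ?Fx = "(\<lambda>g. \<phi> g x0) ` F" and ?Fy = "(\<lambda>g. \<phi> g y0) ` F"
    define V where "V = ?Fx \<union> ?Fy"
    have V: "finite V" "V \<subseteq> topspace T"
      unfolding V_def using F xy action_closed by auto
    obtain U where U: "\<And>v. v \<in> V \<Longrightarrow> openin T (U v) \<and> v \<in> U v"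
      "\<And>v w. v \<in> V \<Longrightarrow> w \<in> V \<Longrightarrow> v \<noteq> w \<Longrightarrow> U v \<inter> U w = {}"
      using Hausdorff_finite_separation[OF metrizable_imp_Hausdorff_space[OF metrizable] V] by metis
    obtain A n where A: "A \<in> \<A>" "closedin T A" "x0 \<in> A" "covering_dim_le (subtopology T A) n"
      and n: "2 * n < int (CARD('r) * card ?Fx)"
      using \<A>[OF xy(1)] by blast
    show ?thesis
    proof (cases "?Fx \<inter> ?Fy = {}")
      case True
      obtain B m where B: "B \<in> \<A>" "closedin T B" "y0 \<in> B" "covering_dim_le (subtopology T B) m"
        and m: "2 * m < int (CARD('r) * card ?Fy)"
        using \<A>[OF xy(2)] by blast
      have "\<forall>v\<in>V. \<exists>g\<in>F. v = \<phi> g (if v \<in> ?Fx then x0 else y0)" unfolding V_def by auto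
      then obtain k where k: "\<And>v. v \<in> V \<Longrightarrow> k v \<in> F \<and> v = \<phi> (k v) (if v \<in> ?Fx then x0 else y0)" by metis
      have kc: "k v \<in> carrier G" if "v \<in> V" for v using k[OF that] F(2) by blast
      have kK: "k v \<in> K" if "v \<in> V" for v using k[OF that] FK by blast
      have kx: "\<phi> (k v) x0 = v" if "v \<in> ?Fx" for v using k[of v] that unfolding V_def by auto
      have ky: "\<phi> (k v) y0 = v" if "v \<in> ?Fy" for v
      proof -
        have "v \<notin> ?Fx" using that True by blast
        then show ?thesis using k[of v] that unfolding V_def by auto
      qed
      have nb1: "openin T {x \<in> mspace X. \<forall>v\<in>?Fx. \<phi> (k v) x \<in> U v}"
        by (rule openin_finite_preimages) (use F kc U in \<open>auto simp: V_def\<close>)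
      have nb2: "x0 \<in> {x \<in> mspace X. \<forall>v\<in>?Fx. \<phi> (k v) x \<in> U v}"
        using xy(1) kx U(1) unfolding V_def by auto
      obtain C where C: "C \<in> \<C>" "x0 \<in> C" "C \<subseteq> {x \<in> mspace X. \<forall>v\<in>?Fx. \<phi> (k v) x \<in> U v}"
        "closedin T C" "covering_dim_le (subtopology T C) n"
        "\<And>x g h. x \<in> C \<Longrightarrow> g \<in> K \<Longrightarrow> h \<in> K \<Longrightarrow> \<phi> g x0 = \<phi> h x0 \<Longrightarrow> \<phi> g x = \<phi> h x"
        by (rule chart_exists[OF K(2) \<Q>(2,3) A nb1 nb2, folded \<C>_def]) (assumption | rule that)+
      have nb1: "openin T {x \<in> mspace X. \<forall>v\<in>?Fy. \<phi> (k v) x \<in> U v}"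
        by (rule openin_finite_preimages) (use F kc U in \<open>auto simp: V_def\<close>)
      have nb2: "y0 \<in> {x \<in> mspace X. \<forall>v\<in>?Fy. \<phi> (k v) x \<in> U v}"
        using xy(2) ky U(1) unfolding V_def by auto
      obtain D where D: "D \<in> \<C>" "y0 \<in> D" "D \<subseteq> {x \<in> mspace X. \<forall>v\<in>?Fy. \<phi> (k v) x \<in> U v}"
        "closedin T D" "covering_dim_le (subtopology T D) m"
        "\<And>x g h. x \<in> D \<Longrightarrow> g \<in> K \<Longrightarrow> h \<in> K \<Longrightarrow> \<phi> g y0 = \<phi> h y0 \<Longrightarrow> \<phi> g x = \<phi> h x"
        by (rule chart_exists[OF K(2) \<Q>(2,3) B nb1 nb2, folded \<C>_def]) (assumption | rule that)+
      define pos where "pos v \<longleftrightarrow> v \<in> ?Fx" for v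
      define CC where "CC b = (if b then C else D)" for b
      define nn where "nn b = (if b then n else m)" for b
      have inU: "\<phi> (k v) ` CC (pos v) \<subseteq> U v" if "v \<in> V" for v
        using that C(3) D(3) unfolding CC_def pos_def V_def by auto
      have "perturbable TYPE('r) T \<phi> F (C \<times> D)"
      proof (rule perturbableI[OF F xy, where k = k and C = CC and n = nn and pos = pos])
        show "k v \<in> carrier G" if "v \<in> ?Fx \<union> ?Fy" for v using kc that unfolding V_def by blast
        show "closedin T (CC b)" for b using C(4) D(4) unfolding CC_def by simp
        show "covering_dim_le (subtopology T (CC b)) (nn b)" for b
          using C(5) D(5) unfolding CC_def nn_def by simp
        show "\<phi> (k v) ` CC (pos v) \<inter> \<phi> (k w) ` CC (pos w) = {}"
          if "v \<in> ?Fx \<union> ?Fy" "w \<in> ?Fx \<union> ?Fy" "v \<noteq> w" for v w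
          using inU[of v] inU[of w] U(2)[of v w] that unfolding V_def by blast
        \<comment> \<open>Disjointness lets the bounds for \<open>x0\<close> and \<open>y0\<close>
          add up to the bound for \<open>V\<close>.\<close>
        have "card (?Fx \<union> ?Fy) = card ?Fx + card ?Fy" using True F by (intro card_Un_disjoint) auto
        then show "2 * (nn True + nn False) < int (CARD('r) * card (?Fx \<union> ?Fy))"
          using n m unfolding nn_def by (simp add: distrib_left)
        fix x y assume z: "(x, y) \<in> C \<times> D"
        \<comment> \<open>The chosen \<open>k (\<phi> g x0)\<close> may differ from
          \<open>g\<close>, but the two agree on \<open>x0\<close> and hence on the chart.\<close>
        have "\<phi> (k (\<phi> g x0)) x = \<phi> g x" if "g \<in> F" for g
          using C(6)[OF _ kK FK[OF that] kx] that z unfolding V_def by blast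
        moreover have "\<phi> (k (\<phi> g y0)) y = \<phi> g y" if "g \<in> F" for g
          using D(6)[OF _ kK FK[OF that] ky] that z unfolding V_def by blast
        moreover have "\<not> pos (\<phi> g y0)" "pos (\<phi> g x0)" if "g \<in> F" for g
          using that True unfolding pos_def by blast+
        ultimately show "\<exists>p. (\<forall>b. p b \<in> CC b) \<and> (\<forall>g\<in>F. \<phi> (k (\<phi> g x0)) (p (pos (\<phi> g x0))) = \<phi> g x \<and>
            \<phi> (k (\<phi> g y0)) (p (pos (\<phi> g y0))) = \<phi> g y)"
          using z by (intro exI[of _ "\<lambda>b. if b then x else y"]) (simp add: CC_def)
      qed
      moreover have "compactin (prod_topology T T) (C \<times> D)"
        using C(4) D(4) closedin_compact_space[OF compact] by (simp add: compactin_Times)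
      ultimately have "C \<times> D \<in> \<Z>" using C(1) D(1) unfolding \<Z>_def \<Z>0_def by blast
      then show ?thesis by (rule bexI[rotated]) (simp add: C(2) D(2))
    next
      \<comment> \<open>Here \<open>y\<^sub>0 = h x\<^sub>0\<close>, so only half as many vertices are available, but the pairs \<open>(x, h x)\<close>
        are parametrised by \<open>x\<close> alone and the second block is a dummy.\<close>
      case False
      then obtain v where v: "v \<in> ?Fx" "v \<in> ?Fy" by blast
      obtain g2 where g2: "v = \<phi> g2 x0" "g2 \<in> F" using v(1) by (rule imageE)
      obtain g1 where g1: "v = \<phi> g1 y0" "g1 \<in> F" using v(2) by (rule imageE)
      have g: "g1 \<in> F" "g2 \<in> F" "\<phi> g1 y0 = \<phi> g2 x0" using g1 g2 by simp_all
      define h where "h = inv g1 \<otimes> g2"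
      have h: "h \<in> H" "h \<in> carrier G" unfolding h_def H_def using g F by auto
      have gc: "g1 \<in> carrier G" "g2 \<in> carrier G" using g F by auto
      have hx: "\<phi> h x0 = y0"
        unfolding h_def using composition_rule[OF xy(1) inv_closed[OF gc(1)] gc(2)] action_inv[OF gc(1) xy(2)] g(3) by simp
      have comp_h: "\<phi> (g \<otimes> h) x = \<phi> g (\<phi> h x)" if "g \<in> F" "x \<in> mspace X" for g x
        using composition_rule[OF that(2) _ h(2)] that(1) F by blast
      have ghK: "g \<otimes> h \<in> K" if "g \<in> F" for g unfolding K_def using that h(1) by blast
      have "\<exists>g\<in>K. \<phi> g x0 = v" if "v \<in> V" for v
        using that comp_h[OF _ xy(1)] hx FK ghK unfolding V_def by (elim UnE imageE) metis+
      then obtain k where k: "\<And>v. v \<in> V \<Longrightarrow> k v \<in> K \<and> \<phi> (k v) x0 = v" by metis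
      have kK: "k v \<in> K" and kx: "\<phi> (k v) x0 = v" if "v \<in> V" for v using k[OF that] by auto
      have kc: "k v \<in> carrier G" if "v \<in> V" for v using kK[OF that] K(2) by blast
      have nb1: "openin T {x \<in> mspace X. \<forall>v\<in>V. \<phi> (k v) x \<in> U v}"
        by (rule openin_finite_preimages) (use V kc U in auto)
      have nb2: "x0 \<in> {x \<in> mspace X. \<forall>v\<in>V. \<phi> (k v) x \<in> U v}"
        using xy(1) k U(1) by auto
      obtain C where C: "C \<in> \<C>" "x0 \<in> C" "C \<subseteq> {x \<in> mspace X. \<forall>v\<in>V. \<phi> (k v) x \<in> U v}"
        "closedin T C" "covering_dim_le (subtopology T C) n"
        "\<And>x g h. x \<in> C \<Longrightarrow> g \<in> K \<Longrightarrow> h \<in> K \<Longrightarrow> \<phi> g x0 = \<phi> h x0 \<Longrightarrow> \<phi> g x = \<phi> h x"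
        by (rule chart_exists[OF K(2) \<Q>(2,3) A nb1 nb2, folded \<C>_def]) (assumption | rule that)+
      define CC where "CC b = (if b then C else {x0})" for b
      define nn where "nn b = (if b then n else 0)" for b
      have "perturbable TYPE('r) T \<phi> F ((\<lambda>x. (x, \<phi> h x)) ` C)"
      proof (rule perturbableI[OF F xy, where k = k and C = CC and n = nn and pos = "\<lambda>_. True"])
        show "k v \<in> carrier G" if "v \<in> ?Fx \<union> ?Fy" for v using kc that unfolding V_def by blast
        have "closedin T {x0}"
          using metrizable_imp_Hausdorff_space[OF metrizable] xy(1) by (simp add: closedin_Hausdorff_singleton)
        then show "closedin T (CC b)" for b using C(4) unfolding CC_def by simp
        have "covering_dim_le (subtopology T {x0}) 0"
          using xy(1) by (intro covering_dim_le_singleton) auto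
        then show "covering_dim_le (subtopology T (CC b)) (nn b)" for b
          using C(5) unfolding CC_def nn_def by simp
        show "\<phi> (k v) ` CC True \<inter> \<phi> (k w) ` CC True = {}"
          if "v \<in> ?Fx \<union> ?Fy" "w \<in> ?Fx \<union> ?Fy" "v \<noteq> w" for v w
          using C(3) U(2)[of v w] that unfolding V_def CC_def by fastforce
        have "2 * (nn True + nn False) = 2 * n" unfolding nn_def by simp
        also have "\<dots> < int (CARD('r) * card ?Fx)" by (rule n)
        also have "\<dots> \<le> int (CARD('r) * card (?Fx \<union> ?Fy))"
          using F by (intro of_nat_mono mult_le_mono2 card_mono) auto
        finally show "2 * (nn True + nn False) < int (CARD('r) * card (?Fx \<union> ?Fy))" .
        fix x y assume "(x, y) \<in> (\<lambda>x. (x, \<phi> h x)) ` C"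
        then have z: "x \<in> C" "y = \<phi> h x" by auto
        then have "x \<in> mspace X" using C(3) by blast
        have "\<phi> (k (\<phi> g x0)) x = \<phi> g x" if "g \<in> F" for g
          using C(6)[OF z(1) kK FK[OF that] kx] that unfolding V_def by blast
        moreover have "\<phi> (k (\<phi> g y0)) x = \<phi> g y" if "g \<in> F" for g
        proof -
          have v: "\<phi> g y0 \<in> V" using that unfolding V_def by blast
          have "\<phi> (k (\<phi> g y0)) x0 = \<phi> (g \<otimes> h) x0"
            using kx[OF v] comp_h[OF that xy(1)] hx by simp
          with z(1) kK[OF v] ghK[OF that] have "\<phi> (k (\<phi> g y0)) x = \<phi> (g \<otimes> h) x"
            by (rule C(6))
          then show ?thesis using comp_h[OF that \<open>x \<in> mspace X\<close>] z(2) by simp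
        qed
        ultimately show "\<exists>p. (\<forall>b. p b \<in> CC b) \<and> (\<forall>g\<in>F. \<phi> (k (\<phi> g x0)) (p True) = \<phi> g x \<and>
            \<phi> (k (\<phi> g y0)) (p True) = \<phi> g y)"
          using z by (intro exI[of _ "\<lambda>b. if b then x else x0"]) (simp add: CC_def)
      qed
      moreover have "compactin (prod_topology T T) ((\<lambda>x. (x, \<phi> h x)) ` C)"
        using closedin_compact_space[OF compact C(4)] continuous_map_action[OF h(2)]
        by (intro image_compactin[where X = T]) (auto intro: continuous_map_pairedI)
      ultimately have "(\<lambda>x. (x, \<phi> h x)) ` C \<in> \<Z>" using C(1) h(1) unfolding \<Z>_def \<Z>0_def by blast
      moreover have "(x0, y0) \<in> (\<lambda>x. (x, \<phi> h x)) ` C"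
        using C(2) hx by (intro image_eqI[of _ _ x0]) simp_all
      ultimately show ?thesis by (rule bexI[rotated])
    qed
  qed
  ultimately show thesis by (intro that[of \<Z>]) (auto simp: \<Z>_def)
qed

end

section \<open>Nowhere density and the theorem\<close>

lemma mspace_unit_cube: "mspace unit_cube = {v. \<forall>i. v $ i \<in> {0..1}}"
  and mdist_unit_cube: "mdist unit_cube = dist"
  and mtopology_of_unit_cube: "mtopology_of unit_cube = subtopology euclidean {v. \<forall>i. v $ i \<in> {0..1}}"
  unfolding unit_cube_def by (simp_all add: mtopology_of_submetric)

lemma continuous_map_vec_nth:
  fixes f :: "'a \<Rightarrow> real ^ 'r"
  assumes "continuous_map T (mtopology_of unit_cube) f"
  shows "continuous_map T euclideanreal (\<lambda>x. f x $ l)"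
proof -
  have "continuous_map T euclidean f"
    using assms unfolding mtopology_of_unit_cube continuous_map_in_subtopology by blast
  moreover have "continuous_map euclidean euclideanreal (\<lambda>v :: real ^ 'r. v $ l)"
    by (simp add: continuous_on_component)
  ultimately have "continuous_map T euclideanreal ((\<lambda>v. v $ l) \<circ> f)" by (rule continuous_map_compose)
  then show ?thesis by (simp add: o_def)
qed

text \<open>Members of the function space are extensional and bounded: restriction gives the first,
  compactness the second.\<close>

lemma cube_function_in_cfunspace:
  fixes f :: "'r::finite \<Rightarrow> 'a \<Rightarrow> real"
  assumes "compact_space T" and f: "\<And>l. continuous_map T euclideanreal (f l)"
    and f01: "\<And>l x. x \<in> topspace T \<Longrightarrow> 0 \<le> f l x \<and> f l x \<le> 1"
  shows "restrict (\<lambda>x. \<chi> l. f l x) (topspace T) \<in> mspace (cfunspace T (unit_cube :: (real ^ 'r) metric))"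
    (is "?f \<in> _")
proof -
  have "continuous_map T euclidean (\<lambda>x. \<chi> l. f l x)"
    using f unfolding continuous_map_atin by (auto intro: vec_tendstoI)
  then have "continuous_map T euclidean ?f" by (rule continuous_map_eq) simp
  moreover have maps: "?f \<in> topspace T \<rightarrow> mspace unit_cube" using f01 by (auto simp: mspace_unit_cube)
  ultimately have cont: "continuous_map T (mtopology_of unit_cube) ?f"
    unfolding mtopology_of_unit_cube continuous_map_in_subtopology mspace_unit_cube by blast
  moreover have "Metric_space.mbounded (mspace unit_cube) (mdist unit_cube) (?f ` topspace T)"
    using image_compactin[OF _ cont] assms(1) Metric_space.compactin_imp_mbounded[OF Metric_space_mspace_mdist]
    unfolding compact_space_def mtopology_of_def by blast
  ultimately show ?thesis unfolding mspace_cfunspace using maps by simp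
qed

context topological_dynamical_system
begin

text \<open>If the closure of \<open>B\<close> contained a ball, \<open>pert\<close> would put into
  it a function separating all pairs of \<open>Z\<close>. By compactness it does so by a uniform
  margin, so nearby functions separate as well and cannot belong to \<open>B\<close>.\<close>

lemma nowhere_dense_not_separating:
  fixes Z :: "('x \<times> 'x) set"
  assumes F: "finite F" "F \<subseteq> carrier G" and Z: "compactin (prod_topology T T) Z"
    and pert: "perturbable TYPE('r::finite) T \<phi> F Z"
    and B: "B \<subseteq> {f \<in> mspace (cfunspace T (unit_cube :: (real ^ 'r) metric)).
        \<exists>(x, y)\<in>Z. \<forall>g\<in>F. f (\<phi> g x) = f (\<phi> g y)}"
  shows "nowhere_dense_in (mtopology_of (cfunspace T (unit_cube :: (real ^ 'r) metric))) B"
proof -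
  let ?CF = "cfunspace T (unit_cube :: (real ^ 'r) metric)"
  interpret CF: Metric_space "mspace ?CF" "mdist ?CF" by (rule Metric_space_mspace_mdist)
  have BCF: "B \<subseteq> mspace ?CF" using B by blast
  have ZX: "x \<in> mspace X \<and> y \<in> mspace X" if "(x, y) \<in> Z" for x y
    using compactin_subset_topspace[OF Z] that by auto
  have "False" if f: "f \<in> CF.mtopology interior_of (CF.mtopology closure_of B)" for f
  proof -
    obtain W where "openin CF.mtopology W" "f \<in> W" "W \<subseteq> CF.mtopology closure_of B"
      using f unfolding interior_of_def by blast
    then obtain r where r: "r > 0" "CF.mball f r \<subseteq> CF.mtopology closure_of B" and fCF: "f \<in> mspace ?CF"
      unfolding CF.openin_mtopology by blast
    have fcont: "continuous_map T (mtopology_of unit_cube) f" and fim: "f \<in> topspace T \<rightarrow> mspace unit_cube"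
      using fCF unfolding mspace_cfunspace by simp_all
    \<comment> \<open>The distance in the cube is at most the sum of the coordinate errors, which
      this choice bounds by \<open>r / 2\<close>.\<close>
    define \<epsilon> where "\<epsilon> = r / (2 * real CARD('r))"
    have "\<epsilon> > 0" unfolding \<epsilon>_def using r(1) by simp
    have f01: "0 \<le> f x $ l \<and> f x $ l \<le> 1" if "x \<in> topspace T" for l x
      using fim that unfolding mspace_unit_cube by auto
    obtain f' :: "'r \<Rightarrow> 'x \<Rightarrow> real" where f':
      "\<And>l. continuous_map T euclideanreal (f' l)"
      "\<And>l x. x \<in> topspace T \<Longrightarrow> 0 \<le> f' l x \<and> f' l x \<le> 1"
      "\<And>l x. x \<in> topspace T \<Longrightarrow> \<bar>f' l x - f x $ l\<bar> < \<epsilon>"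
      "\<And>x y. (x, y) \<in> Z \<Longrightarrow> \<exists>g\<in>F. \<exists>l. f' l (\<phi> g x) \<noteq> f' l (\<phi> g y)"
    proof -
      have "\<exists>f' :: 'r \<Rightarrow> 'x \<Rightarrow> real. (\<forall>l. continuous_map T euclideanreal (f' l)) \<and>
        (\<forall>l. \<forall>x\<in>topspace T. 0 \<le> f' l x \<and> f' l x \<le> 1) \<and>
        (\<forall>l. \<forall>x\<in>topspace T. \<bar>f' l x - f x $ l\<bar> < \<epsilon>) \<and>
        (\<forall>(x, y)\<in>Z. \<exists>g\<in>F. \<exists>l. f' l (\<phi> g x) \<noteq> f' l (\<phi> g y))"
        using pert[unfolded perturbable_def, rule_format, of \<epsilon> "\<lambda>l x. f x $ l"]
          \<open>\<epsilon> > 0\<close> f01 continuous_map_vec_nth[OF fcont] by simp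
      then show thesis using that by fast
    qed
    define h where "h = restrict (\<lambda>x. \<chi> l. f' l x) (topspace T)"
    have h: "h \<in> mspace ?CF" unfolding h_def using compact f'(1,2) by (rule cube_function_in_cfunspace)
    have h_nth: "h x $ l = f' l x" if "x \<in> mspace X" for x l unfolding h_def using that by simp
    have "mdist ?CF f h \<le> r / 2"
    proof (rule mdist_cfunspace_le)
      show "0 \<le> r / 2" using r(1) by simp
      fix x assume x: "x \<in> topspace T"
      have "dist (f x) (h x) \<le> (\<Sum>l\<in>UNIV. \<bar>(f x - h x) $ l\<bar>)"
        unfolding dist_norm by (rule norm_le_l1_cart)
      also have "\<dots> \<le> (\<Sum>l\<in>(UNIV::'r set). \<epsilon>)"
      proof (rule sum_mono)
        fix l
        show "\<bar>(f x - h x) $ l\<bar> \<le> \<epsilon>"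
          using f'(3)[OF x, of l] h_nth[of x l] x by simp
      qed
      also have "\<dots> = r / 2" unfolding \<epsilon>_def by simp
      finally show "mdist unit_cube (f x) (h x) \<le> r / 2" by (simp add: mdist_unit_cube)
    qed
    then have "mdist ?CF f h < r" using r(1) by linarith
    then have "h \<in> CF.mball f r" unfolding CF.in_mball using fCF h by blast
    with r(2) have hcl: "h \<in> CF.mtopology closure_of B" by blast
    define m where "m z = (\<Sum>g\<in>F. \<Sum>l\<in>UNIV. \<bar>f' l (\<phi> g (fst z)) - f' l (\<phi> g (snd z))\<bar>)" for z
    have m_cont: "continuous_map (prod_topology T T) euclideanreal m"
      unfolding m_def
    proof (intro continuous_map_sum continuous_map_real_abs continuous_map_diff)
      fix g l assume "g \<in> F"
      then have "continuous_map T euclideanreal (f' l \<circ> \<phi> g)"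
        using F(2) by (intro continuous_map_compose[OF continuous_map_action f'(1)]) blast
      from continuous_map_compose[OF continuous_map_fst this] continuous_map_compose[OF continuous_map_snd this]
      show "continuous_map (prod_topology T T) euclideanreal (\<lambda>z. f' l (\<phi> g (fst z)))"
        "continuous_map (prod_topology T T) euclideanreal (\<lambda>z. f' l (\<phi> g (snd z)))"
        by (simp_all add: o_def)
    qed (use F in auto)
    have m_pos: "m z > 0" if z: "z \<in> Z" for z
    proof -
      obtain g l where "g \<in> F" "f' l (\<phi> g (fst z)) \<noteq> f' l (\<phi> g (snd z))"
        using f'(4)[of "fst z" "snd z"] z by auto
      then have "0 < (\<Sum>l\<in>UNIV. \<bar>f' l (\<phi> g (fst z)) - f' l (\<phi> g (snd z))\<bar>)"
        by (intro sum_pos2[of UNIV l]) auto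
      then show ?thesis
        unfolding m_def using \<open>g \<in> F\<close> F(1) by (intro sum_pos2[of F g]) (auto intro: sum_nonneg)
    qed
    \<comment> \<open>A minimum over \<open>Z\<close> needs \<open>Z\<close> to be nonempty, which a
      member of \<open>B\<close> witnesses.\<close>
    have "B \<noteq> {}" using hcl by auto
    then have "Z \<noteq> {}" using B by blast
    have "compact (m ` Z)" using image_compactin[OF Z m_cont] by simp
    then obtain z0 where z0: "z0 \<in> Z" "\<And>z. z \<in> Z \<Longrightarrow> m z0 \<le> m z"
      using compact_attains_inf[of "m ` Z"] \<open>Z \<noteq> {}\<close> by blast
    define N where "N = real (card F) * real CARD('r)"
    \<comment> \<open>A function within \<open>\<eta>\<close> of \<open>h\<close> that fails to
      separate \<open>(x, y)\<close> makes each of the \<open>N\<close> terms of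
      \<open>m (x, y)\<close> at most \<open>2 * \<eta>\<close>. The added \<open>1\<close> makes
      the contradiction strict and the denominator positive even for \<open>N = 0\<close>.\<close>
    define \<eta> where "\<eta> = m z0 / (2 * N + 1)"
    have "N \<ge> 0" unfolding N_def by simp
    then have "\<eta> > 0" unfolding \<eta>_def using m_pos[OF z0(1)] by simp
    obtain b where b: "b \<in> B" "b \<in> CF.mball h \<eta>"
      using hcl \<open>\<eta> > 0\<close> unfolding CF.metric_closure_of by blast
    obtain x y where xy: "(x, y) \<in> Z" "\<And>g. g \<in> F \<Longrightarrow> b (\<phi> g x) = b (\<phi> g y)"
      using b(1) B by blast
    have near: "\<bar>f' l x - b x $ l\<bar> \<le> \<eta>" if x: "x \<in> mspace X" for x l
    proof -
      have "b \<in> mspace ?CF" "mdist ?CF h b \<le> \<eta>" using b(2) unfolding CF.in_mball by auto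
      moreover have "x \<in> topspace T" using x by simp
      ultimately have "mdist unit_cube (h x) (b x) \<le> \<eta>"
        by (rule mdist_cfunspace_imp_mdist_le[OF h])
      then have "norm (h x - b x) \<le> \<eta>" by (simp add: mdist_unit_cube dist_norm)
      from norm_bound_component_le_cart[OF this, of l] show ?thesis using h_nth[OF x] by simp
    qed
    have "m z0 \<le> m (x, y)" by (rule z0(2)[OF xy(1)])
    also have "\<dots> \<le> (\<Sum>g\<in>F. \<Sum>l\<in>(UNIV :: 'r set). 2 * \<eta>)"
      unfolding m_def
    proof (intro sum_mono)
      fix g l assume g: "g \<in> F"
      have "\<phi> g x \<in> mspace X" "\<phi> g y \<in> mspace X"
        using ZX[OF xy(1)] g F(2) action_closed by auto
      from near[OF this(1), of l] near[OF this(2), of l] xy(2)[OF g]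
      show "\<bar>f' l (\<phi> g (fst (x, y))) - f' l (\<phi> g (snd (x, y)))\<bar> \<le> 2 * \<eta>"
        unfolding fst_conv snd_conv by (simp add: abs_le_iff)
    qed
    also have "\<dots> = 2 * N * \<eta>" unfolding N_def by simp
    also have "\<dots> < (2 * N + 1) * \<eta>" using \<open>\<eta> > 0\<close> by (simp add: distrib_right)
    also have "\<dots> = m z0" unfolding \<eta>_def using \<open>N \<ge> 0\<close> by simp
    finally show False by simp
  qed
  then have "CF.mtopology interior_of (CF.mtopology closure_of B) = {}" by blast
  moreover have "mtopology_of ?CF = CF.mtopology" by (simp only: mtopology_of_def)
  ultimately show ?thesis
    unfolding nowhere_dense_in_def by (simp only: CF.topspace_mtopology BCF simp_thms)
qed

text \<open>A continuous injection of a compact space into a Hausdorff space is an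
  embedding.\<close>

lemma embedding_map_iff_inj_on:
  assumes F: "F \<subseteq> carrier G" and f: "continuous_map T (mtopology_of m) f"
  shows "embedding_map T (product_topology (\<lambda>_. mtopology_of m) F) (\<lambda>x. \<lambda>g\<in>F. f (\<phi> g x)) \<longleftrightarrow>
    (\<forall>x\<in>mspace X. \<forall>y\<in>mspace X. (\<forall>g\<in>F. f (\<phi> g x) = f (\<phi> g y)) \<longrightarrow> x = y)"
proof -
  let ?f = "\<lambda>x. \<lambda>g\<in>F. f (\<phi> g x)" and ?P = "product_topology (\<lambda>_. mtopology_of m) F"
  have "continuous_map T (mtopology_of m) (\<lambda>x. f (\<phi> g x))" if "g \<in> F" for g
    using continuous_map_compose[OF continuous_map_action f] that F by (auto simp: o_def)
  then have cont: "continuous_map T ?P ?f"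
    unfolding continuous_map_componentwise by auto
  have "Hausdorff_space (mtopology_of m)"
    unfolding mtopology_of_def using Metric_space_mspace_mdist by (rule Metric_space.Hausdorff_space_mtopology)
  then have "Hausdorff_space ?P" by (simp add: Hausdorff_space_product_topology)
  then have "embedding_map T ?P ?f \<longleftrightarrow> inj_on ?f (topspace T)"
    using continuous_imp_embedding_map[OF cont compact] homeomorphic_imp_injective_map
    unfolding embedding_map_def by blast
  also have "\<dots> \<longleftrightarrow> (\<forall>x\<in>mspace X. \<forall>y\<in>mspace X. (\<forall>g\<in>F. f (\<phi> g x) = f (\<phi> g y)) \<longrightarrow> x = y)"
    unfolding inj_on_def by (simp add: restrict_def fun_eq_iff) metis
  finally show ?thesis .
qed

end

lemma int_less_of_ereal_less:
  assumes "ereal (real_of_int n) < ereal (real c * real N / 2)"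
  shows "2 * n < int (c * N)"
proof -
  have "real_of_int (2 * n) < real_of_int (int (c * N))" using assms by simp
  then show ?thesis by (simp only: of_int_less_iff)
qed

theorem theorem1p6:
  fixes G :: "('g, 'm) monoid_scheme" (structure)
    and S :: "'g set"
    and X :: "'x metric"
    and \<phi> :: "'g \<Rightarrow> 'x \<Rightarrow> 'x"
    and M :: nat
    and F :: "'g set"
  assumes "group G"
    and "finite S" and "S \<subseteq> carrier G" and "generate G S = carrier G"
    and "topological_dynamical_system G X \<phi>"
    and "covering_dim (mtopology_of X) < \<infinity>"
    and "\<And>N::nat. N \<ge> 1 \<Longrightarrow>
           covering_dim (subtopology (mtopology_of X) (small_orbit_points G X \<phi> N))
             < ereal (real CARD('r::finite) * real N / 2)"
    and "M = (LEAST m::nat. m \<ge> 1 \<and>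
           ereal (real m) > 2 * covering_dim (mtopology_of X) / ereal (real CARD('r)))"
    and "F = products_up_to_length G S (M - 1)"
  shows "comeagre_in (mtopology_of (cfunspace (mtopology_of X) (unit_cube :: (real ^ 'r) metric)))
           {f \<in> mspace (cfunspace (mtopology_of X) (unit_cube :: (real ^ 'r) metric)).
              embedding_map (mtopology_of X)
                (product_topology (\<lambda>_. mtopology_of (unit_cube :: (real ^ 'r) metric)) F)
                (\<lambda>x. \<lambda>g\<in>F. f (\<phi> g x))}"
proof -
  interpret topological_dynamical_system G X \<phi> by (rule assms(5))
  interpret group G by (rule assms(1))
  let ?C = "cfunspace T (unit_cube :: (real ^ 'r) metric)" and ?r = "CARD('r)"
  define E where "E = {f \<in> mspace ?C. embedding_map T
      (product_topology (\<lambda>_. mtopology_of (unit_cube :: (real ^ 'r) metric)) F) (\<lambda>x. \<lambda>g\<in>F. f (\<phi> g x))}"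
  have F: "finite F" "F \<subseteq> carrier G"
    unfolding assms(9) using finite_products_up_to_length[OF assms(2)] products_up_to_length_closed[OF assms(3)] by auto
  \<comment> \<open>Finite dimension makes \<open>LEAST\<close> meaningful; passing to
    \<open>Suc m\<close> secures positivity.\<close>
  have "\<exists>m::nat. m \<ge> 1 \<and> ereal (real m) > 2 * covering_dim T / ereal (real ?r)"
  proof -
    have "2 * covering_dim T / ereal (real ?r) \<noteq> \<infinity>"
      using assms(6) by (cases "covering_dim T") (auto simp: ereal_divide_eq)
    then obtain m :: nat where "2 * covering_dim T / ereal (real ?r) < ereal (real m)"
      unfolding less_PInf_Ex_of_nat by blast
    also have "ereal (real m) \<le> ereal (real (Suc m))" by simp
    finally show ?thesis by (intro exI[of _ "Suc m"]) simp
  qed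
  then have "M \<ge> 1 \<and> ereal (real M) > 2 * covering_dim T / ereal (real ?r)"
    unfolding assms(8) by (rule LeastI_ex)
  then have M: "M \<ge> 1" "2 * covering_dim T / ereal (real ?r) < ereal (real M)" by auto
  have "covering_dim T < ereal (real ?r * real M / 2)"
    using M(2) assms(6) by (cases "covering_dim T") (auto simp: field_simps)
  then obtain nX where nX: "covering_dim_le T nX" "2 * nX < int (?r * M)"
    using covering_dim_lessE int_less_of_ereal_less by metis
  \<comment> \<open>The whole space serves points with at least \<open>M\<close> translates under
    \<open>F\<close>, the other sets those with orbits of fewer than \<open>M\<close>
    points.\<close>
  define \<A> where "\<A> = insert (mspace X) (small_orbit_points G X \<phi> ` {1..<M})"
  have "countable \<A>" unfolding \<A>_def by (simp add: countable_finite)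
  have dims: "\<exists>A\<in>\<A>. \<exists>n. closedin T A \<and> x \<in> A \<and> covering_dim_le (subtopology T A) n \<and>
      2 * n < int (?r * card ((\<lambda>g. \<phi> g x) ` F))" if x: "x \<in> mspace X" for x
  proof -
    \<comment> \<open>For \<open>n = M - 1\<close> the alternative \<open>n < card\<close> of
      \<open>orbit_growth\<close> reads \<open>M \<le> card\<close>; otherwise \<open>F\<close>
      already exhausts the orbit.\<close>
    consider "M \<le> card ((\<lambda>g. \<phi> g x) ` F)"
      | "card ((\<lambda>g. \<phi> g x) ` F) < M" "(\<lambda>g. \<phi> g x) ` F = orbit G \<phi> x"
      using orbit_growth[OF assms(2,3,4) x, of "M - 1"] M(1) unfolding assms(9) by linarith
    then show ?thesis
    proof cases
      case 1
      have "2 * nX < int (?r * M)" by (rule nX(2))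
      also have "\<dots> \<le> int (?r * card ((\<lambda>g. \<phi> g x) ` F))" using 1 by (intro of_nat_mono mult_le_mono2)
      finally have "2 * nX < int (?r * card ((\<lambda>g. \<phi> g x) ` F))" .
      moreover have "subtopology T (mspace X) = T" using subtopology_topspace[of T] by simp
      moreover have "closedin T (mspace X)" using closedin_topspace[of T] by simp
      ultimately show ?thesis using nX(1) x unfolding \<A>_def by (intro bexI[of _ "mspace X"] exI[of _ nX]) auto
    next
      case 2
      define N where "N = card (orbit G \<phi> x)"
      have fin: "finite (orbit G \<phi> x)" unfolding 2(2)[symmetric] using F(1) by simp
      have "x \<in> orbit G \<phi> x" unfolding orbit_def using action_one[OF x] one_closed by force
      then have N: "1 \<le> N" "N < M" unfolding N_def using fin 2 by (auto simp: Suc_le_eq card_gt_0_iff)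
      obtain n where n: "covering_dim_le (subtopology T (small_orbit_points G X \<phi> N)) n" "2 * n < int (?r * N)"
        using covering_dim_lessE[OF assms(7)[OF N(1)]] int_less_of_ereal_less by metis
      have "x \<in> small_orbit_points G X \<phi> N" unfolding small_orbit_points_def N_def using x fin by simp
      moreover have "small_orbit_points G X \<phi> N \<in> \<A>" unfolding \<A>_def using N by simp
      ultimately show ?thesis using n closedin_small_orbit_points unfolding 2(2) N_def by blast
    qed
  qed
  obtain \<Z> where \<Z>: "countable \<Z>"
    "\<And>Z. Z \<in> \<Z> \<Longrightarrow> compactin (prod_topology T T) Z \<and> perturbable TYPE('r) T \<phi> F Z"
    "\<And>x y. x \<in> mspace X \<Longrightarrow> y \<in> mspace X \<Longrightarrow> x \<noteq> y \<Longrightarrow> \<exists>Z\<in>\<Z>. (x, y) \<in> Z"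
    using countable_perturbable_cover[OF F \<open>countable \<A>\<close> dims] by metis
  \<comment> \<open>The condition \<open>f \<notin> E\<close> puts the union inside the complement
    of \<open>E\<close> at once, as \<open>meagre_in\<close> asks for an equality of sets.\<close>
  define B where "B Z = {f \<in> mspace ?C. f \<notin> E \<and> (\<exists>(x, y)\<in>Z. \<forall>g\<in>F. f (\<phi> g x) = f (\<phi> g y))}" for Z
  have nwd: "nowhere_dense_in (mtopology_of ?C) (B Z)" if "Z \<in> \<Z>" for Z
    using \<Z>(2)[OF that] unfolding B_def by (intro nowhere_dense_not_separating[OF F]) auto
  have "mspace ?C - E = \<Union>(B ` \<Z>)"
  proof
    show "\<Union>(B ` \<Z>) \<subseteq> mspace ?C - E" unfolding B_def by blast
    show "mspace ?C - E \<subseteq> \<Union>(B ` \<Z>)"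
    proof
      fix f assume f: "f \<in> mspace ?C - E"
      then have "continuous_map T (mtopology_of unit_cube) f" by simp
      from embedding_map_iff_inj_on[OF F(2) this] f
      obtain x y where "x \<in> mspace X" "y \<in> mspace X" "x \<noteq> y" and eq: "\<forall>g\<in>F. f (\<phi> g x) = f (\<phi> g y)"
        unfolding E_def by blast
      then obtain Z where "Z \<in> \<Z>" "(x, y) \<in> Z" using \<Z>(3) by blast
      with f eq show "f \<in> \<Union>(B ` \<Z>)" unfolding B_def by blast
    qed
  qed
  then have "meagre_in (mtopology_of ?C) (topspace (mtopology_of ?C) - E)"
    unfolding meagre_in_def topspace_mtopology_of
    using \<Z>(1) nwd by (intro exI[of _ "B ` \<Z>"]) blast
  moreover have "E \<subseteq> topspace (mtopology_of ?C)" unfolding topspace_mtopology_of E_def by blast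
  ultimately show ?thesis unfolding comeagre_in_def E_def by blast
qed

end
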